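(* Let $\ell\ge 5$ be a prime number, $V$ a finite-dimensional $\mathbf{Q}_\ell$-vector space, $T$ a $\mathbf{Z}_\ell$-lattice in $V$, and $g$ a quasi-unipotent linear operator on $V$ with $g(T)=T$. Let $k$ and $m$ be positive integers with $2 \le k \le \dim(V)-2$. If $(\wedge^k(g)-1)^{m(\ell-1)} \in \ell^m\,\mathrm{End}(\wedge^k(T))$, then $\wedge^k(g)$ is unipotent.
   Context: A linear operator is quasi-unipotent if some positive power of it is unipotent (equivalently, all its eigenvalues are roots of unity). $\wedge^k(g)$ denotes the induced operator on the $k$-th exterior power, and $\wedge^k(T)$ is regarded as a $\mathbf{Z}_\ell$-lattice in $\wedge^k(V)$. *)

theory Defs
  imports "Jordan_Normal_Form.Determinant" "Jordan_Normal_Form.DL_Submatrix"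
begin

text \<open>
  Encoding of Z_l-matrices.  A matrix A in M_n(Z_l) is represented by a compatible
  family of integer n x n matrices  G j  (j = 0,1,2,...), where G j is a representative
  of A mod l^j, i.e.  G (j+1) = G j  (mod l^j) entrywise (inverse-limit description
  Z_l = lim Z/l^j).  A Z_l-matrix is zero iff all its truncations vanish mod l^j, and
  it lies in l^m M(Z_l) iff its truncation mod l^m vanishes mod l^m.
\<close>

definition ladic_family :: "nat \<Rightarrow> nat \<Rightarrow> (nat \<Rightarrow> int mat) \<Rightarrow> bool" where
  "ladic_family l n G \<longleftrightarrow>
     (\<forall>j. G j \<in> carrier_mat n n) \<and>
     (\<forall>j a b. a < n \<longrightarrow> b < n \<longrightarrow> G (Suc j) $$ (a,b) mod (int l ^ j) = G j $$ (a,b) mod (int l ^ j))"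

text \<open>The k-element subsets of {0..<n}: index set of the standard basis e_I of wedge^k.\<close>
definition ksets :: "nat \<Rightarrow> nat \<Rightarrow> nat set set" where
  "ksets n k = {I. I \<subseteq> {..<n} \<and> card I = k}"

text \<open>Matrix of wedge^k(A) in the basis e_I = e_{i1} wedge ... wedge e_{ik} (i1<...<ik):
  entry (I,J) is the k x k minor of A with rows I and columns J.\<close>
definition compound :: "nat \<Rightarrow> 'a::comm_ring_1 mat \<Rightarrow> nat set \<Rightarrow> nat set \<Rightarrow> 'a" where
  "compound k A I J = det (submatrix A I J)"

definition smat_mult :: "'i set \<Rightarrow> ('i \<Rightarrow> 'i \<Rightarrow> 'a::comm_ring_1) \<Rightarrow> ('i \<Rightarrow> 'i \<Rightarrow> 'a) \<Rightarrow> 'i \<Rightarrow> 'i \<Rightarrow> 'a" where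
  "smat_mult S A B = (\<lambda>I J. \<Sum>K\<in>S. A I K * B K J)"

definition smat_one :: "'i \<Rightarrow> 'i \<Rightarrow> 'a::comm_ring_1" where
  "smat_one = (\<lambda>I J. if I = J then 1 else 0)"

fun smat_pow :: "'i set \<Rightarrow> ('i \<Rightarrow> 'i \<Rightarrow> 'a::comm_ring_1) \<Rightarrow> nat \<Rightarrow> 'i \<Rightarrow> 'i \<Rightarrow> 'a" where
  "smat_pow S A 0 = smat_one"
| "smat_pow S A (Suc r) = smat_mult S A (smat_pow S A r)"

definition wedge_minus_one_pow :: "nat \<Rightarrow> nat \<Rightarrow> int mat \<Rightarrow> nat \<Rightarrow> nat set \<Rightarrow> nat set \<Rightarrow> int" where
  "wedge_minus_one_pow n k A r =
     smat_pow (ksets n k) (\<lambda>I J. compound k A I J - smat_one I J) r"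

definition quasi_unipotent_fam :: "nat \<Rightarrow> nat \<Rightarrow> (nat \<Rightarrow> int mat) \<Rightarrow> bool" where
  "quasi_unipotent_fam l n G \<longleftrightarrow>
     (\<exists>N>0. \<exists>M. \<forall>j a b. a < n \<longrightarrow> b < n \<longrightarrow>
        int l ^ j dvd ((G j ^\<^sub>m N - 1\<^sub>m n) ^\<^sub>m M) $$ (a,b))"

definition wedge_unipotent_fam :: "nat \<Rightarrow> nat \<Rightarrow> nat \<Rightarrow> (nat \<Rightarrow> int mat) \<Rightarrow> bool" where
  "wedge_unipotent_fam l n k G \<longleftrightarrow>
     (\<exists>M. \<forall>j. \<forall>I\<in>ksets n k. \<forall>J\<in>ksets n k.
        int l ^ j dvd wedge_minus_one_pow n k (G j) M I J)"

end

theory Submission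
  imports Defs "Jordan_Normal_Form.Char_Poly"
begin

text \<open>
  Let \<open>h\<close> be the compound matrix of \<open>g\<close>. The hypothesis on \<open>h\<close> passes to powers of \<open>g\<close>; modulo \<open>\<ell>\<close> it
  says that \<open>h\<close> is unipotent, so it suffices that some \<open>g\<^sup>c\<close> with \<open>c\<close> prime to \<open>\<ell>\<close> is unipotent. By descent
  this reduces to showing: if \<open>g\<^sup>\<ell>\<close> is unipotent and \<open>g\<close> is not, then the hypothesis fails.

  For matrices \<open>U\<close> and \<open>V\<close> the hypothesis and the Cauchy--Binet formula give a divisibility by \<open>\<ell>\<^sup>m\<close> of
  the \<open>m (\<ell> - 1)\<close>-th finite difference of the sequence \<open>j \<mapsto> det (U g\<^sup>j V)\<close>. If \<open>g\<^sup>\<ell>\<close> is unipotent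
  and \<open>g\<close> is not, the lattice contains a saturated copy of \<open>\<int>\<^sub>\<ell>[\<zeta>]\<close> on which \<open>g\<close> acts as
  multiplication by \<open>\<zeta>\<close>, and \<open>g\<^sup>\<ell>\<close> is unitriangular in a basis adapted to it. Since \<open>2 \<le> k \<le> n - 2\<close>
  and \<open>\<ell> \<ge> 5\<close>, this allows to choose \<open>U\<close> and \<open>V\<close> such that the sequence is the indicator function of the multiples
  of \<open>\<ell>\<close>, whose finite difference is exactly divisible by \<open>\<ell>\<^sup>m\<^sup>-\<^sup>1\<close>, by an argument going back to Fleck.
\<close>

section \<open>Polynomials acting on sequences and on matrices\<close>

text \<open>No eigenvalue is ever adjoined: the argument stays over the l-adic integers, where the
  norm polynomial 1 + X + ... + X^(l-1) plays the part of zeta. The hypothesis can be tested against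
  any linear functional of the powers of \<open>h\<close>; those of the form det (U g^j V) are
  useful because they can be computed from g alone. The indicator of the multiples of l is the
  target because (X - 1)^(l-1) is congruent to the norm polynomial modulo l, and the norm polynomial
  turns the indicator into the constant 1. What is left modulo l^m is a value at 1, equal to l^(m-1)
  up to sign.

  The bounds come from a window of residues 0, ..., i-1 together with the residue i+1. For i = 1 the
  two residues are translates of each other, so i >= 2; the residue i+1 must be one of the l - 1
  coordinates of zeta-powers, so i <= l - 3, and both are possible only for l >= 5. The other k - i
  rows must fit into the n - (l-1) remaining coordinates, which such an i allows exactly when 2 <= k
  <= n - 2.\<close>

definition umbral :: "'a::comm_ring_1 poly \<Rightarrow> (nat \<Rightarrow> 'a) \<Rightarrow> 'a" where
  "umbral q f = (\<Sum>j\<le>degree q. coeff q j * f j)"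

lemma umbral_bound:
  assumes "degree q \<le> N"
  shows "umbral q f = (\<Sum>j\<le>N. coeff q j * f j)"
  unfolding umbral_def
  by (rule sum.mono_neutral_left) (use assms in \<open>auto simp: coeff_eq_0\<close>)

lemma umbral_0 [simp]: "umbral 0 f = 0"
  by (simp add: umbral_def)

lemma umbral_1 [simp]: "umbral 1 f = f 0"
  by (simp add: umbral_def)

lemma umbral_pCons: "umbral (pCons a q) f = a * f 0 + umbral q (\<lambda>j. f (Suc j))"
proof -
  have "umbral (pCons a q) f = (\<Sum>j\<le>Suc (degree q). coeff (pCons a q) j * f j)"
    by (rule umbral_bound) (simp add: degree_pCons_le)
  also have "\<dots> = a * f 0 + (\<Sum>j\<le>degree q. coeff q j * f (Suc j))"
    by (subst sum.atMost_Suc_shift) simp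
  finally show ?thesis by (simp add: umbral_def)
qed

lemma umbral_add: "umbral (p + q) f = umbral p f + umbral q f"
proof -
  define N where "N = max (degree p) (degree q)"
  have "degree (p + q) \<le> N" "degree p \<le> N" "degree q \<le> N"
    unfolding N_def by (auto intro: degree_add_le)
  then show ?thesis
    by (simp add: umbral_bound[where N = N] sum.distrib[symmetric] ring_distribs)
qed

lemma umbral_smult: "umbral (smult c q) f = c * umbral q f"
  by (subst umbral_bound[where N = "degree q"])
    (auto simp: umbral_def sum_distrib_left mult.assoc degree_smult_le)

lemma umbral_sum_left: "umbral (\<Sum>c\<in>S. q c) f = (\<Sum>c\<in>S. umbral (q c) f)"
  by (induction S rule: infinite_finite_induct) (auto simp: umbral_add)

text \<open>\<open>umbral q f\<close> is the value at \<open>q\<close> of the linear functional X^j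
  -> f j. Multiplication by X becomes a shift of the sequence, so factorizations of polynomials act
  as successive operations on sequences.\<close>

lemma umbral_mult: "umbral (p * q) f = umbral p (\<lambda>t. umbral q (\<lambda>j. f (t + j)))"
proof (induction p arbitrary: f)
  case 0
  then show ?case by simp
next
  case (pCons a p)
  have "umbral (pCons a p * q) f = a * umbral q f + umbral (p * q) (\<lambda>j. f (Suc j))"
    by (simp add: umbral_add umbral_smult umbral_pCons)
  then show ?case by (simp add: umbral_pCons pCons.IH)
qed

lemma umbral_sum: "umbral q (\<lambda>j. \<Sum>c\<in>S. f c j) = (\<Sum>c\<in>S. umbral q (f c))"
  unfolding umbral_def sum_distrib_left by (rule sum.swap)

lemma umbral_cmult: "umbral q (\<lambda>j. c * f j) = c * umbral q f"
  unfolding umbral_def by (simp add: sum_distrib_left algebra_simps)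

lemma umbral_const: "umbral q (\<lambda>j. 1) = poly q 1"
  by (simp add: umbral_def poly_altdef)

lemma umbral_monom: "umbral (monom c e) f = c * f e"
proof -
  have "umbral (monom c e) f = (\<Sum>j\<le>e. if j = e then c * f e else 0)"
    unfolding umbral_bound[OF degree_monom_le] by (rule sum.cong) auto
  then show ?thesis by simp
qed

section \<open>Polynomials evaluated at a square matrix\<close>

lemma pow_mat_add:
  assumes "A \<in> carrier_mat n n"
  shows "A ^\<^sub>m (i + j) = A ^\<^sub>m i * A ^\<^sub>m j"
  by (induction j) (use assms in \<open>auto simp: assoc_mult_mat[of _ n n _ n _ n]\<close>)

lemma pow_mat_mult:
  assumes "A \<in> carrier_mat n n"
  shows "A ^\<^sub>m (i * j) = (A ^\<^sub>m i) ^\<^sub>m j"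
  by (induction j) (use assms in \<open>auto simp: pow_mat_add[OF assms] add.commute[of i]\<close>)

text \<open>The matrix q(A). Going through \<open>umbral\<close> links divisibility of q(A) with
  finite differences of the entries of the powers of A.\<close>

definition pmat :: "'a::comm_ring_1 poly \<Rightarrow> 'a mat \<Rightarrow> 'a mat" where
  "pmat q A = mat (dim_row A) (dim_row A) (\<lambda>(a, b). umbral q (\<lambda>j. (A ^\<^sub>m j) $$ (a, b)))"

lemma pmat_index:
  "A \<in> carrier_mat n n \<Longrightarrow> a < n \<Longrightarrow> b < n \<Longrightarrow>
    pmat q A $$ (a, b) = umbral q (\<lambda>j. (A ^\<^sub>m j) $$ (a, b))"
  by (auto simp: pmat_def)

lemma pmat_carrier [simp]: "A \<in> carrier_mat n n \<Longrightarrow> pmat q A \<in> carrier_mat n n"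
  by (auto simp: pmat_def)

lemma pmat_dim [simp]: "dim_row (pmat q A) = dim_row A" "dim_col (pmat q A) = dim_row A"
  by (auto simp: pmat_def)

lemma pmat_add: "A \<in> carrier_mat n n \<Longrightarrow> pmat (p + q) A = pmat p A + pmat q A"
  by (rule eq_matI) (auto simp: pmat_index umbral_add)

lemma pmat_smult: "A \<in> carrier_mat n n \<Longrightarrow> pmat (smult c q) A = c \<cdot>\<^sub>m pmat q A"
  by (rule eq_matI) (auto simp: pmat_index umbral_smult)

lemma pmat_monom: "A \<in> carrier_mat n n \<Longrightarrow> pmat (monom 1 e) A = A ^\<^sub>m e"
  by (rule eq_matI) (auto simp: pmat_index umbral_monom split: if_splits)

lemma pmat_1: "A \<in> carrier_mat n n \<Longrightarrow> pmat 1 A = 1\<^sub>m n"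
  by (rule eq_matI) (auto simp: pmat_index)

lemma pmat_mult:
  assumes A: "A \<in> carrier_mat n n"
  shows "pmat (p * q) A = pmat p A * pmat q A"
proof (rule eq_matI)
  fix a b assume "a < dim_row (pmat p A * pmat q A)" "b < dim_col (pmat p A * pmat q A)"
  then have ab: "a < n" "b < n" using A by auto
  have pw: "(A ^\<^sub>m (t + j)) $$ (a, b) = (\<Sum>c<n. (A ^\<^sub>m t) $$ (a, c) * (A ^\<^sub>m j) $$ (c, b))" for t j
    using A ab unfolding pow_mat_add[OF A]
    by (simp add: times_mat_def scalar_prod_def atLeast0LessThan pow_carrier_mat[THEN carrier_matD(1)]
        pow_carrier_mat[THEN carrier_matD(2)])
  have "pmat (p * q) A $$ (a, b)
      = umbral p (\<lambda>t. umbral q (\<lambda>j. \<Sum>c<n. (A ^\<^sub>m t) $$ (a, c) * (A ^\<^sub>m j) $$ (c, b)))"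
    using A ab by (simp add: pmat_index umbral_mult pw)
  also have "\<dots> = (\<Sum>c<n. umbral p (\<lambda>t. (A ^\<^sub>m t) $$ (a, c) * umbral q (\<lambda>j. (A ^\<^sub>m j) $$ (c, b))))"
    by (simp add: umbral_sum umbral_cmult)
  also have "\<dots> = (\<Sum>c<n. pmat p A $$ (a, c) * pmat q A $$ (c, b))"
  proof (rule sum.cong[OF refl])
    fix c assume "c \<in> {..<n}"
    moreover have "umbral p (\<lambda>t. (A ^\<^sub>m t) $$ (a, c) * y) = umbral p (\<lambda>t. (A ^\<^sub>m t) $$ (a, c)) * y" for y
      using umbral_cmult[of p y "\<lambda>t. (A ^\<^sub>m t) $$ (a, c)"] by (simp add: mult.commute)
    ultimately show "umbral p (\<lambda>t. (A ^\<^sub>m t) $$ (a, c) * umbral q (\<lambda>j. (A ^\<^sub>m j) $$ (c, b)))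
        = pmat p A $$ (a, c) * pmat q A $$ (c, b)"
      using A ab by (simp add: pmat_index)
  qed
  also have "\<dots> = (pmat p A * pmat q A) $$ (a, b)"
    using A ab by (simp add: times_mat_def scalar_prod_def atLeast0LessThan)
  finally show "pmat (p * q) A $$ (a, b) = (pmat p A * pmat q A) $$ (a, b)" .
qed (use A in auto)

lemma pmat_power: "A \<in> carrier_mat n n \<Longrightarrow> pmat (q ^ r) A = pmat q A ^\<^sub>m r"
  by (induction r) (auto simp: pmat_1 pmat_mult power_Suc2 simp del: power_Suc)

lemma pmat_diff: "A \<in> carrier_mat n n \<Longrightarrow> pmat (p - q) A = pmat p A - pmat q A"
  using pmat_add[of A n p "- q"] pmat_smult[of A n "- 1" q]
  by (intro eq_matI) auto

lemma pmat_monom_minus_1: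
  "A \<in> carrier_mat n n \<Longrightarrow> pmat (monom 1 e - 1) A = A ^\<^sub>m e - 1\<^sub>m n"
  by (simp add: pmat_diff pmat_monom pmat_1)

lemma linear_eq_monom: "[:- 1, 1:] = (monom 1 1 - 1 :: 'a::comm_ring_1 poly)"
  by (rule poly_eqI) (auto simp: coeff_pCons split: nat.splits)

lemma pmat_linear:
  assumes "A \<in> carrier_mat n n"
  shows "pmat [:- 1, 1:] A = A - 1\<^sub>m n"
  using pmat_monom_minus_1[OF assms, of 1] assms by (simp only: linear_eq_monom) simp

section \<open>Unipotence and the polynomial (X^e - 1)/(X - 1)\<close>

definition unipotent :: "nat \<Rightarrow> 'a::comm_ring_1 mat \<Rightarrow> bool" where
  "unipotent n A \<longleftrightarrow> (\<exists>M. (A - 1\<^sub>m n) ^\<^sub>m M = 0\<^sub>m n n)"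

definition geom_poly :: "nat \<Rightarrow> 'a::comm_ring_1 poly" where
  "geom_poly e = (\<Sum>j<e. monom 1 j)"

lemma coeff_geom_poly: "coeff (geom_poly e) j = (if j < e then 1 else 0)"
  by (simp add: geom_poly_def coeff_sum)

lemma monom_minus_1_factor: "monom 1 e - 1 = [:- 1, 1:] * geom_poly e"
proof (induction e)
  case 0
  then show ?case by (simp add: geom_poly_def monom_0)
next
  case (Suc e)
  have "[:- 1, 1:] * geom_poly (Suc e) = [:- 1, 1:] * geom_poly e + [:- 1, 1:] * monom 1 e"
    by (simp add: geom_poly_def algebra_simps)
  also have "[:- 1, 1:] * monom (1::'a) e = monom 1 (Suc e) - monom 1 e"
    by (simp add: monom_Suc)
  finally show ?case by (simp only: Suc.IH[symmetric]) simp
qed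

lemma poly_geom_poly_1: "poly (geom_poly e) 1 = of_nat e"
  by (simp add: geom_poly_def poly_sum poly_monom)

lemma umbral_geom_poly: "umbral (geom_poly e) f = (\<Sum>j<e. f j)"
  by (simp add: geom_poly_def umbral_sum_left umbral_monom)

lemma coeff_linear_power:
  "coeff ([:- 1, 1:] ^ r) j = (of_int ((- 1) ^ (r + j) * int (r choose j)) :: 'a::comm_ring_1)"
proof (induction r arbitrary: j)
  case 0
  then show ?case by (cases j) simp_all
next
  case (Suc r)
  have "coeff ([:- 1, 1:] ^ Suc r) j
      = (case j of 0 \<Rightarrow> 0 | Suc i \<Rightarrow> coeff ([:- 1, 1:] ^ r) i) - coeff ([:- 1, 1::'a:] ^ r) j"
    by (simp add: coeff_pCons split: nat.splits)
  then show ?case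
    by (cases j) (simp_all add: Suc.IH algebra_simps)
qed

text \<open>By Pascal's rule neighbouring entries of row p - 1 add up to an entry of row p, which is
  divisible by p; so the row is 1, -1, 1, ... modulo p.\<close>

lemma choose_prime_minus_1_cong:
  assumes p: "prime p" and "j < p"
  shows "int p dvd (- 1) ^ j * int ((p - 1) choose j) - 1"
  using \<open>j < p\<close>
proof (induction j)
  case 0
  then show ?case by simp
next
  case (Suc j)
  have "p dvd p choose Suc j"
    using Suc.prems p by (intro dvd_choose_prime) auto
  moreover have "p choose Suc j = ((p - 1) choose j) + ((p - 1) choose Suc j)"
    using Suc.prems by (cases p) auto
  ultimately have "int p dvd int ((p - 1) choose j) + int ((p - 1) choose Suc j)"
    by (metis int_dvd_int_iff of_nat_add)
  then have "int p dvd (- 1) ^ j * (int ((p - 1) choose j) + int ((p - 1) choose Suc j))"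
    by (rule dvd_mult)
  moreover have "int p dvd (- 1) ^ j * int ((p - 1) choose j) - 1"
    using Suc by simp
  moreover have "(- 1) ^ Suc j * int ((p - 1) choose Suc j) - 1
      = ((- 1) ^ j * int ((p - 1) choose j) - 1)
        - (- 1) ^ j * (int ((p - 1) choose j) + int ((p - 1) choose Suc j))"
    by (simp only: power_Suc) (simp add: algebra_simps)
  ultimately show ?case by (metis dvd_diff)
qed

text \<open>In characteristic p the norm polynomial (X^p - 1)/(X - 1) is (X - 1)^(p-1). The cofactor
  \<open>q\<close> of the error is kept because its value at 1 is needed: once p can be cancelled,
  it is -1.\<close>

lemma linear_power_prime:
  assumes p: "prime p" and "p \<noteq> 2"
  obtains q where "[:- 1, 1:] ^ (p - 1) = geom_poly p + smult (of_nat p) (q :: 'a::comm_ring_1 poly)"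
proof -
  have "odd p" using assms primes_dvd_imp_eq two_is_prime_nat by blast
  have ex: "\<exists>z. (- 1) ^ j * int ((p - 1) choose j) - 1 = int p * z" if "j < p" for j
    using choose_prime_minus_1_cong[OF p that] by (auto simp: dvd_def)
  then obtain z where z: "\<And>j. j < p \<Longrightarrow> (- 1) ^ j * int ((p - 1) choose j) - 1 = int p * z j"
    by metis
  define q where "q = (\<Sum>j<p. monom (of_int (z j) :: 'a) j)"
  have "[:- 1, 1:] ^ (p - 1) = geom_poly p + smult (of_nat p) q"
  proof (rule poly_eqI)
    fix j
    have c: "coeff q j = (if j < p then of_int (z j) else 0)"
      by (simp add: q_def coeff_sum)
    have s: "(- 1 :: int) ^ (p - 1 + j) = (- 1) ^ j"
      using \<open>odd p\<close> by (simp add: power_add)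
    show "coeff ([:- 1, 1:] ^ (p - 1)) j = coeff (geom_poly p + smult (of_nat p) q) j"
    proof (cases "j < p")
      case True
      have "(- 1) ^ j * int ((p - 1) choose j) = 1 + int p * z j"
        using z[OF True] by simp
      then have "of_int ((- 1) ^ j * int ((p - 1) choose j)) = (of_int (1 + int p * z j) :: 'a)"
        by simp
      then show ?thesis
        unfolding coeff_linear_power s using True by (simp add: coeff_geom_poly c)
    next
      case False
      then show ?thesis
        using prime_gt_0_nat[OF p] unfolding coeff_linear_power
        by (simp add: coeff_geom_poly c binomial_eq_0)
    qed
  qed
  then show ?thesis by (rule that)
qed

section \<open>Discrete valuation rings with uniformizer \<open>p\<close>\<close>

lemma ex1_complement_residue:
  fixes t p :: nat
  assumes "p > 0"
  shows "\<exists>!j. j < p \<and> p dvd t + j"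
proof (rule ex1I)
  let ?r = "if t mod p = 0 then 0 else p - t mod p"
  have "t mod p < p" using assms by simp
  moreover have "t + (p - t mod p) = p * (t div p) + p"
    using mult_div_mod_eq[of p t] \<open>t mod p < p\<close> by linarith
  ultimately show r: "?r < p \<and> p dvd t + ?r" using assms by auto
  fix j assume j: "j < p \<and> p dvd t + j"
  have "int p dvd int (t + j) - int (t + ?r)"
    using j r by (intro dvd_diff) (simp_all only: int_dvd_int_iff)
  then have "int p dvd int j - int ?r" by simp
  moreover have "\<bar>int j - int ?r\<bar> < int p" using j r by linarith
  ultimately show "j = ?r" using dvd_imp_le_int[of "int j - int ?r" "int p"] by fastforce
qed

text \<open>Axioms of a discrete valuation ring whose uniformizer is the rational prime
  \<open>p\<close> itself. The lattice arguments run in this setting and are instantiated once, at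
  the type \<open>padic\<close>.\<close>

locale ladic_ring =
  fixes p :: nat and R :: "'a::idom itself"
  assumes prime_p: "prime p"
    and p_nonzero: "(of_nat p :: 'a) \<noteq> 0"
    and p_nonunit: "\<not> (of_nat p :: 'a) dvd 1"
    and valuation: "\<And>x::'a. x \<noteq> 0 \<Longrightarrow> \<exists>s u. x = of_nat p ^ s * u \<and> u dvd 1"
begin

abbreviation \<pi> :: 'a where "\<pi> \<equiv> of_nat p"

lemma unit_iff: "(x::'a) dvd 1 \<longleftrightarrow> \<not> \<pi> dvd x"
proof
  assume "x dvd 1"
  then show "\<not> \<pi> dvd x" using p_nonunit dvd_trans by blast
next
  assume x: "\<not> \<pi> dvd x"
  then have "x \<noteq> 0" by auto
  then obtain s u where su: "x = \<pi> ^ s * u" "u dvd 1" using valuation by blast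
  with x have "s = 0" by (cases s) auto
  with su show "x dvd 1" by simp
qed

lemma pi_prime: "\<pi> dvd x * y \<longleftrightarrow> \<pi> dvd x \<or> \<pi> dvd (y::'a)"
  using unit_iff[of x] unit_iff[of y] unit_iff[of "x * y"]
  by (metis dvd_mult dvd_mult2 is_unit_mult_iff)

lemma pi_prime_power: "\<pi> dvd x ^ e \<longleftrightarrow> \<pi> dvd (x::'a) \<and> e > 0"
proof (induction e)
  case 0
  show ?case using p_nonunit by simp
next
  case (Suc e)
  then show ?case using pi_prime[of x "x ^ e"] unfolding power_Suc by blast
qed

lemma pi_dvd_of_int: "\<pi> dvd of_int c \<longleftrightarrow> int p dvd c"
proof
  assume *: "\<pi> dvd of_int c"
  show "int p dvd c"
  proof (rule ccontr)
    assume "\<not> int p dvd c"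
    then have "gcd (int p) c = 1"
      using prime_imp_coprime[of "int p" c] prime_p by (simp add: coprime_iff_gcd_eq_1)
    then obtain x y where "x * int p + y * c = 1" using bezout_int[of "int p" c] by auto
    then have "of_int (x * int p + y * c) = (1::'a)" by simp
    then have "of_int x * \<pi> + of_int y * of_int c = 1" by simp
    moreover have "\<pi> dvd of_int x * \<pi> + of_int y * of_int c"
      using * by (intro dvd_add dvd_mult) simp_all
    ultimately have "\<pi> dvd 1" by simp
    with p_nonunit show False by simp
  qed
next
  assume "int p dvd c"
  then obtain d where "c = int p * d" by (rule dvdE)
  then have "of_int c = \<pi> * of_int d" by simp
  then show "\<pi> dvd of_int c" by simp
qed

lemma pi_dvd_of_nat: "\<pi> dvd of_nat c \<longleftrightarrow> p dvd c"
  using pi_dvd_of_int[of "int c"] by simp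

lemma pi_power_dvd_imp_zero:
  assumes "\<And>s. \<pi> ^ s dvd (x::'a)"
  shows "x = 0"
proof (rule ccontr)
  assume "x \<noteq> 0"
  then obtain s u where su: "x = \<pi> ^ s * u" "u dvd 1" using valuation by blast
  from assms[of "Suc s"] su have "\<pi> dvd u" using p_nonzero by simp
  with su unit_iff show False by blast
qed

text \<open>\<open>f a\<close> has finite valuation, so some largest power of \<open>p\<close>
  divides all values on \<open>S\<close>. This makes vectors primitive.\<close>

lemma extract_content:
  fixes f :: "'i \<Rightarrow> 'a"
  assumes "finite S" "a \<in> S" "f a \<noteq> 0"
  obtains s g where "\<And>b. b \<in> S \<Longrightarrow> f b = \<pi> ^ s * g b" "\<exists>b\<in>S. \<not> \<pi> dvd g b"
proof -
  define P where "P s \<longleftrightarrow> (\<forall>b\<in>S. \<pi> ^ s dvd f b)" for s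
  have "\<exists>s. \<not> P s" using assms pi_power_dvd_imp_zero[of "f a"] unfolding P_def by blast
  then have n: "\<not> P (LEAST s. \<not> P s)" by (rule LeastI_ex)
  have "P 0" by (simp add: P_def)
  with n obtain s where s: "(LEAST s. \<not> P s) = Suc s" by (metis not0_implies_Suc)
  then have "P s" using not_less_Least[of s "\<lambda>s. \<not> P s"] by auto
  then obtain g where g: "\<And>b. b \<in> S \<Longrightarrow> f b = \<pi> ^ s * g b"
    unfolding P_def dvd_def by metis
  obtain b where "b \<in> S" "\<not> \<pi> ^ Suc s dvd f b" using n s P_def by auto
  with g have "\<not> \<pi> dvd g b" by (metis mult_dvd_mono dvd_refl power_Suc2)
  with g \<open>b \<in> S\<close> show ?thesis using that by blast
qed

text \<open>Modulo \<open>X ^ p - 1\<close> every multiple of the norm polynomial is a scalar multiple of it; the scalar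
  is read off by evaluating at 1, where \<open>X - 1\<close> vanishes.\<close>

lemma Fleck_not_dvd:
  assumes "p \<noteq> 2" "m > 0"
  shows "\<not> \<pi> ^ m dvd umbral ([:- 1, 1:] ^ (m * (p - 1))) (\<lambda>j. if p dvd j then 1 else 0)"
    (is "\<not> _ dvd umbral _ ?d")
proof
  have p1: "p > 1" using prime_p prime_gt_1_nat by blast
  obtain q :: "'a poly" where q: "[:- 1, 1:] ^ (p - 1) = geom_poly p + smult \<pi> q"
    using linear_power_prime[OF prime_p assms(1)] by blast
  have "poly (geom_poly p + smult \<pi> q) 1 = 0" using p1 unfolding q[symmetric] by simp
  then have "\<pi> * (1 + poly q 1) = 0" by (simp add: poly_geom_poly_1 algebra_simps)
  then have q1: "poly q 1 = - 1"
    using p_nonzero by (simp add: eq_neg_iff_add_eq_0 add.commute)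
  \<comment> \<open>Modulo the norm polynomial N, the power (N + p q)^m is (p q)^m. At 1 the whole
    power vanishes and q is -1, so s(1) p = -(-p)^m, that is s(1) = (-p)^(m-1).\<close>
  have "geom_poly p dvd (geom_poly p + smult \<pi> q) ^ m - smult \<pi> q ^ m"
    using power_diff_sumr2[of "geom_poly p + smult \<pi> q" m "smult \<pi> q"] by simp
  then obtain s where s: "(geom_poly p + smult \<pi> q) ^ m = s * geom_poly p + smult \<pi> q ^ m"
    by (metis dvdE diff_eq_eq mult.commute)
  have "poly ((geom_poly p + smult \<pi> q) ^ m) 1 = 0"
    using assms(2) by (simp add: poly_geom_poly_1 q1)
  then have "poly s 1 * \<pi> + (- \<pi>) ^ m = 0"
    unfolding s by (simp add: poly_geom_poly_1 q1)
  moreover obtain m' where m': "m = Suc m'" using assms(2) gr0_implies_Suc by blast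
  ultimately have "\<pi> * poly s 1 = \<pi> * (- \<pi>) ^ m'"
    by (simp add: eq_neg_iff_add_eq_0 mult.commute)
  then have "poly s 1 = (- \<pi>) ^ m'" using p_nonzero mult_left_cancel by blast
  then have s1: "poly s 1 = (- 1) ^ m' * \<pi> ^ m'" by (metis power_minus)
  \<comment> \<open>Among p consecutive integers exactly one is a multiple of p, so N turns every
    shift of the indicator into 1, and \<open>s\<close> then contributes s(1).\<close>
  have gd: "umbral (geom_poly p) (\<lambda>j. ?d (t + j)) = 1" for t
  proof -
    have "\<exists>!j. j < p \<and> p dvd t + j" by (rule ex1_complement_residue) (use p1 in simp)
    then obtain r where r: "r < p" "\<forall>j<p. p dvd t + j \<longleftrightarrow> j = r" by metis
    have "(\<Sum>j<p. ?d (t + j)) = (\<Sum>j<p. if j = r then 1 else (0::'a))"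
      by (rule sum.cong) (simp_all add: r(2))
    then show ?thesis using r(1) by (simp add: umbral_geom_poly)
  qed
  assume "\<pi> ^ m dvd umbral ([:- 1, 1:] ^ (m * (p - 1))) ?d"
  moreover have "umbral ([:- 1, 1:] ^ (m * (p - 1))) ?d = poly s 1 + \<pi> ^ m * umbral (q ^ m) ?d"
    unfolding mult.commute[of m] power_mult q s
    by (simp add: umbral_add umbral_mult gd umbral_const smult_power umbral_smult)
  ultimately have "\<pi> ^ m dvd poly s 1" by (simp add: dvd_add_left_iff)
  then have "\<pi> ^ m dvd \<pi> ^ m'" unfolding s1
    by (cases "even m'") simp_all
  then show False unfolding m' using p_nonzero p_nonunit by simp
qed

end

section \<open>Compound matrices and the Cauchy--Binet formula\<close>

lemma permutes_less: "s permutes {0..<k} \<Longrightarrow> i < k \<Longrightarrow> s i < (k::nat)"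
  using permutes_in_image[of s "{0..<k}" i] by simp

lemma det_zero_row:
  assumes A: "A \<in> carrier_mat n n" and "i < n" and z: "\<And>j. j < n \<Longrightarrow> A $$ (i, j) = 0"
  shows "det A = 0"
  unfolding det_def'[OF A]
proof (rule sum.neutral, rule ballI)
  fix s assume "s \<in> {s. s permutes {0..<n}}"
  then have "(\<Prod>i = 0..<n. A $$ (i, s i)) = 0"
    using assms(2) z by (intro prod_zero bexI[of _ i]) (auto simp: permutes_less)
  then show "signof s * (\<Prod>i = 0..<n. A $$ (i, s i)) = 0" by simp
qed

lemma det_zero_col:
  assumes A: "A \<in> carrier_mat n n" and "j < n" and z: "\<And>i. i < n \<Longrightarrow> A $$ (i, j) = 0"
  shows "det A = 0"
  using det_zero_row[of "transpose_mat A" n j] det_transpose[OF A] assms by auto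

lemma finite_ksets: "finite (ksets n k)"
  by (rule finite_subset[of _ "Pow {..<n}"]) (auto simp: ksets_def)

lemma bij_betw_pick:
  assumes "K \<in> ksets n k"
  shows "bij_betw (pick K) {0..<k} K"
proof -
  have K: "card K = k" "finite K" using assms finite_subset by (auto simp: ksets_def)
  have inj: "inj_on (pick K) {0..<k}"
  proof (rule inj_onI)
    fix i j assume "i \<in> {0..<k}" "j \<in> {0..<k}" "pick K i = pick K j"
    then show "i = j"
      using pick_mono_le[of i K j] pick_mono_le[of j K i] K by (cases i j rule: linorder_cases) auto
  qed
  moreover have "pick K ` {0..<k} \<subseteq> K" using pick_in_set_le K by auto
  ultimately have "pick K ` {0..<k} = K"
    using K by (intro card_subset_eq) (auto simp: card_image)
  with inj show ?thesis by (simp add: bij_betw_def)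
qed

lemma pick_less: "K \<in> ksets n k \<Longrightarrow> i < k \<Longrightarrow> pick K i < n"
  using bij_betw_pick[of K n k] by (auto simp: bij_betw_def ksets_def)

lemma pick_inj: "K \<in> ksets n k \<Longrightarrow> i < k \<Longrightarrow> j < k \<Longrightarrow> pick K i = pick K j \<longleftrightarrow> i = j"
  using bij_betw_pick[of K n k] by (auto simp: bij_betw_def inj_on_def)

lemma submatrix_ksets:
  assumes "A \<in> carrier_mat nr nc" "I \<in> ksets nr k" "J \<in> ksets nc k"
  shows "submatrix A I J = mat k k (\<lambda>(i, j). A $$ (pick I i, pick J j))"
proof -
  have "{i. i < nr \<and> i \<in> I} = I" "{j. j < nc \<and> j \<in> J} = J"
    using assms by (auto simp: ksets_def)
  then show ?thesis using assms by (simp add: submatrix_def ksets_def)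
qed

lemma compound_det:
  assumes "A \<in> carrier_mat nr nc" "I \<in> ksets nr k" "J \<in> ksets nc k"
  shows "compound k A I J = det (mat k k (\<lambda>(i, j). A $$ (pick I i, pick J j)))"
  by (simp add: compound_def submatrix_ksets[OF assms])

text \<open>A map from k points onto a k-element set differs from the increasing enumeration by a
  unique permutation. This parametrizes the terms of \<open>Cauchy_Binet\<close> that belong to one
  minor.\<close>

lemma bij_betw_permutes_pick:
  assumes K: "K \<in> ksets n k"
  shows "bij_betw (\<lambda>s. restrict (pick K \<circ> s) {0..<k}) {s. s permutes {0..<k}}
    {f \<in> {0..<k} \<rightarrow>\<^sub>E {..<n}. f ` {0..<k} = K}"
proof (rule bij_betw_imageI)
  let ?e = "pick K"
  have e: "bij_betw ?e {0..<k} K" by (rule bij_betw_pick[OF K])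
  show "inj_on (\<lambda>s. restrict (?e \<circ> s) {0..<k}) {s. s permutes {0..<k}}"
  proof (rule inj_onI)
    fix s t assume s: "s \<in> {s. s permutes {0..<k}}" and t: "t \<in> {s. s permutes {0..<k}}"
      and eq: "restrict (?e \<circ> s) {0..<k} = restrict (?e \<circ> t) {0..<k}"
    show "s = t"
    proof
      fix i
      show "s i = t i"
      proof (cases "i \<in> {0..<k}")
        case True
        then have "?e (s i) = ?e (t i)" using fun_cong[OF eq, of i] by simp
        moreover have "s i \<in> {0..<k}" "t i \<in> {0..<k}"
          using s t True permutes_in_image by (metis mem_Collect_eq)+
        ultimately show ?thesis using pick_inj[OF K] by simp
      next
        case False
        then show ?thesis using s t by (simp add: permutes_not_in)
      qed
    qed
  qed
  show "(\<lambda>s. restrict (?e \<circ> s) {0..<k}) ` {s. s permutes {0..<k}}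
      = {f \<in> {0..<k} \<rightarrow>\<^sub>E {..<n}. f ` {0..<k} = K}"
  proof (intro equalityI subsetI)
    fix f assume "f \<in> (\<lambda>s. restrict (?e \<circ> s) {0..<k}) ` {s. s permutes {0..<k}}"
    then obtain s where s: "s permutes {0..<k}" and f: "f = restrict (?e \<circ> s) {0..<k}" by auto
    have "f ` {0..<k} = ?e ` s ` {0..<k}" by (auto simp: f)
    also have "\<dots> = K" using permutes_image[OF s] e by (simp add: bij_betw_def)
    finally have "f ` {0..<k} = K" .
    moreover have "K \<subseteq> {..<n}" using K by (simp add: ksets_def)
    ultimately show "f \<in> {f \<in> {0..<k} \<rightarrow>\<^sub>E {..<n}. f ` {0..<k} = K}"
      unfolding f by (auto simp: PiE_iff)
  next
    fix f assume "f \<in> {f \<in> {0..<k} \<rightarrow>\<^sub>E {..<n}. f ` {0..<k} = K}"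
    then have f: "f \<in> extensional {0..<k}" "f ` {0..<k} = K" by (auto simp: PiE_iff)
    have "inj_on f {0..<k}"
      by (rule eq_card_imp_inj_on) (use f K in \<open>auto simp: ksets_def\<close>)
    then have fb: "bij_betw f {0..<k} K" using f by (simp add: bij_betw_def)
    define s where "s i = (if i \<in> {0..<k} then the_inv_into {0..<k} ?e (f i) else i)" for i
    have "bij_betw (the_inv_into {0..<k} ?e \<circ> f) {0..<k} {0..<k}"
      by (rule bij_betw_trans[OF fb bij_betw_the_inv_into[OF e]])
    then have "bij_betw s {0..<k} {0..<k}"
      by (rule bij_betw_cong[THEN iffD1, rotated]) (simp add: s_def)
    then have "s permutes {0..<k}"
      by (rule bij_imp_permutes) (simp add: s_def)
    moreover have "restrict (?e \<circ> s) {0..<k} = f"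
    proof
      fix i
      show "restrict (?e \<circ> s) {0..<k} i = f i"
      proof (cases "i \<in> {0..<k}")
        case True
        then have "f i \<in> K" using f by auto
        then have "?e (the_inv_into {0..<k} ?e (f i)) = f i"
          using e by (intro f_the_inv_into_f) (auto simp: bij_betw_def)
        then show ?thesis using True by (simp add: s_def)
      next
        case False
        then show ?thesis using f(1) by (simp add: extensional_def restrict_def del: atLeastLessThan_iff)
      qed
    qed
    ultimately show "f \<in> (\<lambda>s. restrict (?e \<circ> s) {0..<k}) ` {s. s permutes {0..<k}}"
      by (intro image_eqI[of f _ s]) auto
  qed
qed

text \<open>Expanding the entries of A B gives a sum over all maps f from row indices to inner
  indices. If f has a repetition, two rows of B coincide; the other f are grouped by their image K,
  and sorting the rows of B supplies the signs that rebuild the minor of A.\<close>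

lemma Cauchy_Binet:
  fixes A B :: "'a::comm_ring_1 mat"
  assumes A: "A \<in> carrier_mat k n" and B: "B \<in> carrier_mat n k"
  shows "det (A * B) = (\<Sum>K\<in>ksets n k. det (mat k k (\<lambda>(i, j). A $$ (i, pick K j)))
    * det (mat k k (\<lambda>(i, j). B $$ (pick K i, j))))"
proof -
  let ?P = "{s. s permutes {0..<k}}" and ?F = "{0..<k} \<rightarrow>\<^sub>E {..<n}"
  define D where "D f = det (mat k k (\<lambda>(i, j). B $$ (f i, j)))" for f :: "nat \<Rightarrow> nat"
  define t where "t f = (\<Prod>i = 0..<k. A $$ (i, f i)) * D f" for f
  have fF: "finite ?F" by (intro finite_PiE) auto
  have D_cong: "D f = D g" if "\<And>i. i < k \<Longrightarrow> f i = g i" for f g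
    unfolding D_def by (rule arg_cong[of _ _ det], rule eq_matI) (use that in auto)
  have "det (A * B) = (\<Sum>s\<in>?P. signof s * (\<Prod>i = 0..<k. \<Sum>c<n. A $$ (i, c) * B $$ (c, s i)))"
    unfolding det_def'[OF mult_carrier_mat[OF A B]]
  proof (intro sum.cong refl arg_cong[of _ _ "(*) _"] prod.cong)
    fix s i assume "s \<in> ?P" "i \<in> {0..<k}"
    then have "i < k" "s i < k" using permutes_in_image[of s "{0..<k}" i] by auto
    then show "(A * B) $$ (i, s i) = (\<Sum>c<n. A $$ (i, c) * B $$ (c, s i))"
      using A B by (simp add: times_mat_def scalar_prod_def atLeast0LessThan)
  qed
  also have "\<dots> = (\<Sum>s\<in>?P. \<Sum>f\<in>?F. signof s * (\<Prod>i = 0..<k. A $$ (i, f i) * B $$ (f i, s i)))"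
    by (simp add: prod_sum_PiE sum_distrib_left)
  also have "\<dots> = (\<Sum>f\<in>?F. t f)"
    unfolding t_def D_def
    by (subst sum.swap, rule sum.cong[OF refl], subst det_def'[of _ k],
        auto simp: sum_distrib_left prod.distrib algebra_simps permutes_less intro!: sum.cong prod.cong)
  also have "\<dots> = (\<Sum>f\<in>{f \<in> ?F. inj_on f {0..<k}}. t f)"
  proof (rule sum.mono_neutral_right[OF fF])
    show "\<forall>f\<in>?F - {f \<in> ?F. inj_on f {0..<k}}. t f = 0"
    proof
      fix f assume "f \<in> ?F - {f \<in> ?F. inj_on f {0..<k}}"
      then obtain i j where ij: "i < k" "j < k" "i \<noteq> j" "f i = f j" by (auto simp: inj_on_def)
      have "D f = 0" unfolding D_def
        by (rule det_identical_rows[of _ k i j]) (use ij in \<open>auto intro!: eq_vecI\<close>)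
      then show "t f = 0" by (simp add: t_def)
    qed
  qed auto
  also have "\<dots> = (\<Sum>K\<in>ksets n k. \<Sum>f\<in>{f \<in> {f \<in> ?F. inj_on f {0..<k}}. f ` {0..<k} = K}. t f)"
  proof (rule sum.group[symmetric, OF _ finite_ksets])
    show "(\<lambda>f. f ` {0..<k}) ` {f \<in> ?F. inj_on f {0..<k}} \<subseteq> ksets n k"
      by (auto simp: ksets_def card_image PiE_iff)
  qed (use fF in auto)
  also have "\<dots> = (\<Sum>K\<in>ksets n k. det (mat k k (\<lambda>(i, j). A $$ (i, pick K j)))
    * det (mat k k (\<lambda>(i, j). B $$ (pick K i, j))))"
  proof (rule sum.cong[OF refl])
    fix K assume K: "K \<in> ksets n k"
    have *: "{f \<in> {f \<in> ?F. inj_on f {0..<k}}. f ` {0..<k} = K} = {f \<in> ?F. f ` {0..<k} = K}"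
      using K by (auto simp: ksets_def intro!: eq_card_imp_inj_on)
    have "(\<Sum>f\<in>{f \<in> {f \<in> ?F. inj_on f {0..<k}}. f ` {0..<k} = K}. t f)
        = (\<Sum>s\<in>?P. t (restrict (pick K \<circ> s) {0..<k}))"
      unfolding * by (rule sum.reindex_bij_betw[OF bij_betw_permutes_pick[OF K], symmetric])
    also have "\<dots> = (\<Sum>s\<in>?P. signof s * (\<Prod>i = 0..<k. A $$ (i, pick K (s i))) * D (pick K))"
    proof (rule sum.cong[OF refl])
      fix s assume "s \<in> ?P"
      then have s: "s permutes {0..<k}" by simp
      have "D (restrict (pick K \<circ> s) {0..<k}) = D (pick K \<circ> s)" by (rule D_cong) auto
      also have "\<dots> = det (mat k k (\<lambda>(i, j). mat k k (\<lambda>(i, j). B $$ (pick K i, j)) $$ (s i, j)))"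
        unfolding D_def by (rule arg_cong[of _ _ det], rule eq_matI) (use s in \<open>auto simp: permutes_less\<close>)
      also have "\<dots> = signof s * D (pick K)"
        unfolding D_def by (rule det_permute_rows[OF _ s]) simp
      finally show "t (restrict (pick K \<circ> s) {0..<k})
          = signof s * (\<Prod>i = 0..<k. A $$ (i, pick K (s i))) * D (pick K)"
        unfolding t_def by simp
    qed
    also have "\<dots> = det (mat k k (\<lambda>(i, j). A $$ (i, pick K j))) * D (pick K)"
      by (subst det_def'[of _ k])
        (auto simp: sum_distrib_right permutes_less intro!: sum.cong prod.cong)
    finally show "(\<Sum>f\<in>{f \<in> {f \<in> ?F. inj_on f {0..<k}}. f ` {0..<k} = K}. t f)
        = det (mat k k (\<lambda>(i, j). A $$ (i, pick K j))) * det (mat k k (\<lambda>(i, j). B $$ (pick K i, j)))"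
      by (simp add: D_def)
  qed
  finally show ?thesis .
qed

text \<open>Functoriality of the exterior power: rows are selected in X and columns in Y before
  \<open>Cauchy_Binet\<close> is applied. Rectangular factors are allowed so that it also covers U
  (k x n) and V (n x k).\<close>

lemma compound_mult:
  assumes X: "X \<in> carrier_mat nr n" and Y: "Y \<in> carrier_mat n nc"
    and I: "I \<in> ksets nr k" and J: "J \<in> ksets nc k"
  shows "compound k (X * Y) I J = (\<Sum>K\<in>ksets n k. compound k X I K * compound k Y K J)"
proof -
  let ?A = "mat k n (\<lambda>(i, c). X $$ (pick I i, c))" and ?B = "mat n k (\<lambda>(c, j). Y $$ (c, pick J j))"
  have "mat k k (\<lambda>(i, j). (X * Y) $$ (pick I i, pick J j)) = ?A * ?B"
    using pick_less[OF I] pick_less[OF J] X Y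
    by (intro eq_matI) (auto simp: times_mat_def scalar_prod_def)
  then have "compound k (X * Y) I J = det (?A * ?B)"
    using compound_det[OF mult_carrier_mat[OF X Y] I J] by simp
  also have "\<dots> = (\<Sum>K\<in>ksets n k. compound k X I K * compound k Y K J)"
    unfolding Cauchy_Binet[of ?A k n ?B, OF mat_carrier mat_carrier]
  proof (rule sum.cong[OF refl], rule arg_cong2[of _ _ _ _ "(*)"])
    fix K assume K: "K \<in> ksets n k"
    show "det (mat k k (\<lambda>(i, j). ?A $$ (i, pick K j))) = compound k X I K"
      unfolding compound_det[OF X I K]
      by (rule arg_cong[of _ _ det], rule eq_matI) (use pick_less[OF K] in auto)
    show "det (mat k k (\<lambda>(i, j). ?B $$ (pick K i, j))) = compound k Y K J"
      unfolding compound_det[OF Y K J]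
      by (rule arg_cong[of _ _ det], rule eq_matI) (use pick_less[OF K] in auto)
  qed
  finally show ?thesis .
qed

lemma compound_one:
  assumes I: "I \<in> ksets n k" and J: "J \<in> ksets n k"
  shows "compound k (1\<^sub>m n) I J = (smat_one I J :: 'a::comm_ring_1)"
proof (cases "I = J")
  case True
  have "mat k k (\<lambda>(i, j). 1\<^sub>m n $$ (pick I i, pick I j)) = (1\<^sub>m k :: 'a mat)"
    using pick_less[OF I] pick_inj[OF I] by (intro eq_matI) auto
  moreover have "compound k (1\<^sub>m n :: 'a mat) I I
      = det (mat k k (\<lambda>(i, j). 1\<^sub>m n $$ (pick I i, pick I j)))"
    by (rule compound_det[OF one_carrier_mat I I])
  ultimately show ?thesis using True by (simp add: smat_one_def)
next
  case False
  have fin: "finite I" "finite J" "card I = card J"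
    using I J finite_subset by (auto simp: ksets_def)
  with False obtain x where "x \<in> I" "x \<notin> J" by (metis card_subset_eq subsetI)
  moreover have "pick I ` {0..<k} = I" using bij_betw_pick[OF I] by (simp add: bij_betw_def)
  ultimately obtain i where i: "i < k" "pick I i = x" by (metis atLeastLessThan_iff imageE)
  let ?M = "mat k k (\<lambda>(i, j). 1\<^sub>m n $$ (pick I i, pick J j)) :: 'a mat"
  have "?M $$ (i, j) = 0" if "j < k" for j
  proof -
    have "pick J j \<in> J" using bij_betw_pick[OF J] that by (auto simp: bij_betw_def)
    then show ?thesis using that i \<open>x \<notin> J\<close> pick_less[OF I i(1)] pick_less[OF J that] by auto
  qed
  then have "det ?M = 0"
    by (intro det_zero_row[OF _ i(1)]) auto
  moreover have "compound k (1\<^sub>m n) I J = det ?M"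
    by (rule compound_det[OF one_carrier_mat I J])
  ultimately show ?thesis using False by (simp add: smat_one_def)
qed

section \<open>The compound as an ordinary square matrix\<close>

definition kset_enum :: "nat \<Rightarrow> nat \<Rightarrow> nat \<Rightarrow> nat set" where
  "kset_enum n k = (SOME e. bij_betw e {0..<card (ksets n k)} (ksets n k))"

lemma bij_betw_kset_enum: "bij_betw (kset_enum n k) {0..<card (ksets n k)} (ksets n k)"
  unfolding kset_enum_def by (rule someI_ex[OF ex_bij_betw_nat_finite[OF finite_ksets]])

lemma kset_enum_in: "a < card (ksets n k) \<Longrightarrow> kset_enum n k a \<in> ksets n k"
  using bij_betw_kset_enum[of n k] by (auto simp: bij_betw_def)

lemma kset_enum_eq_iff:
  "a < card (ksets n k) \<Longrightarrow> b < card (ksets n k) \<Longrightarrow> kset_enum n k a = kset_enum n k b \<longleftrightarrow> a = b"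
  using bij_betw_kset_enum[of n k] by (auto simp: bij_betw_def inj_on_def)

lemma kset_enum_cases:
  assumes "I \<in> ksets n k"
  obtains a where "a < card (ksets n k)" "I = kset_enum n k a"
proof -
  have "kset_enum n k ` {0..<card (ksets n k)} = ksets n k"
    using bij_betw_kset_enum by (auto simp: bij_betw_def)
  with assms that show ?thesis by (metis atLeastLessThan_iff imageE)
qed

lemma sum_ksets: "(\<Sum>K\<in>ksets n k. f K) = (\<Sum>a = 0..<card (ksets n k). f (kset_enum n k a))"
  by (rule sum.reindex_bij_betw[OF bij_betw_kset_enum, symmetric])

text \<open>With k-subsets replaced by numbers, the calculus of matrix powers and
  \<open>pmat\<close> applies. The enumeration is arbitrary: unipotence and entrywise divisibility
  do not depend on it.\<close>

definition cmat :: "nat \<Rightarrow> nat \<Rightarrow> 'a::comm_ring_1 mat \<Rightarrow> 'a mat" where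
  "cmat n k A = mat (card (ksets n k)) (card (ksets n k))
     (\<lambda>(a, b). compound k A (kset_enum n k a) (kset_enum n k b))"

lemma cmat_carrier [simp]: "cmat n k A \<in> carrier_mat (card (ksets n k)) (card (ksets n k))"
  by (simp add: cmat_def)

lemma cmat_index: "a < card (ksets n k) \<Longrightarrow> b < card (ksets n k) \<Longrightarrow>
    cmat n k A $$ (a, b) = compound k A (kset_enum n k a) (kset_enum n k b)"
  by (simp add: cmat_def)

lemma cmat_mult:
  assumes "A \<in> carrier_mat n n" "B \<in> carrier_mat n n"
  shows "cmat n k (A * B) = cmat n k A * cmat n k B"
proof (rule eq_matI)
  let ?d = "card (ksets n k)"
  fix a b assume "a < dim_row (cmat n k A * cmat n k B)" "b < dim_col (cmat n k A * cmat n k B)"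
  then have ab: "a < ?d" "b < ?d" by (simp_all add: cmat_def)
  then have "(cmat n k A * cmat n k B) $$ (a, b)
      = (\<Sum>c = 0..<?d. cmat n k A $$ (a, c) * cmat n k B $$ (c, b))"
    by (simp add: scalar_prod_def carrier_matD[OF cmat_carrier])
  also have "\<dots> = cmat n k (A * B) $$ (a, b)"
    using ab by (simp add: cmat_index compound_mult[OF assms kset_enum_in kset_enum_in] sum_ksets)
  finally show "cmat n k (A * B) $$ (a, b) = (cmat n k A * cmat n k B) $$ (a, b)" ..
qed (simp_all add: cmat_def)

lemma cmat_one: "cmat n k (1\<^sub>m n) = 1\<^sub>m (card (ksets n k))"
  by (rule eq_matI) (auto simp: cmat_def compound_one kset_enum_in smat_one_def kset_enum_eq_iff)

lemma cmat_pow: "A \<in> carrier_mat n n \<Longrightarrow> cmat n k (A ^\<^sub>m j) = cmat n k A ^\<^sub>m j"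
  by (induction j) (auto simp: cmat_one cmat_mult carrier_matD[OF cmat_carrier])

lemma smat_pow_cmat:
  assumes "a < card (ksets n k)" "b < card (ksets n k)"
  shows "smat_pow (ksets n k) (\<lambda>I J. compound k A I J - smat_one I J) r (kset_enum n k a) (kset_enum n k b)
    = ((cmat n k A - 1\<^sub>m (card (ksets n k))) ^\<^sub>m r) $$ (a, b)"
  using assms
proof (induction r arbitrary: a b)
  case 0
  then show ?case by (simp add: smat_one_def kset_enum_eq_iff)
next
  case (Suc r)
  let ?d = "card (ksets n k)"
  let ?X = "cmat n k A - 1\<^sub>m ?d"
  have X: "?X \<in> carrier_mat ?d ?d" by (intro minus_carrier_mat) simp
  have ent: "?X $$ (a, c) = compound k A (kset_enum n k a) (kset_enum n k c)
      - smat_one (kset_enum n k a) (kset_enum n k c)" if "c < ?d" for c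
    using Suc.prems that by (simp add: cmat_def smat_one_def kset_enum_eq_iff)
  have "?X ^\<^sub>m Suc r = ?X * ?X ^\<^sub>m r"
    using pow_mat_add[OF X, of 1 r] X by simp
  then have "(?X ^\<^sub>m Suc r) $$ (a, b) = (\<Sum>c = 0..<?d. ?X $$ (a, c) * (?X ^\<^sub>m r) $$ (c, b))"
    using Suc.prems X pow_carrier_mat[OF X, of r]
    by (simp add: times_mat_def scalar_prod_def carrier_matD)
  then show ?case using Suc by (simp add: smat_mult_def sum_ksets ent del: index_minus_mat)
qed

section \<open>Exploiting the divisibility hypothesis\<close>

definition mat_dvd :: "'a::comm_ring_1 \<Rightarrow> 'a mat \<Rightarrow> bool" where
  "mat_dvd x M \<longleftrightarrow> (\<forall>a<dim_row M. \<forall>b<dim_col M. x dvd M $$ (a, b))"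

lemma mat_dvd_mult_left:
  assumes "M \<in> carrier_mat n m" "N \<in> carrier_mat m l" "mat_dvd x M"
  shows "mat_dvd x (M * N)"
  using assms unfolding mat_dvd_def
  by (auto simp: times_mat_def scalar_prod_def intro!: dvd_sum dvd_mult2)

lemma pick_lessThan: "i < k \<Longrightarrow> pick {..<k} i = i"
proof -
  assume "i < k"
  then have "{a \<in> {..<k}. a < i} = {..<i}" by auto
  then show ?thesis using pick_card_in_set[of i "{..<k}"] \<open>i < k\<close> by simp
qed

lemma compound_full:
  assumes "M \<in> carrier_mat k k"
  shows "compound k M {..<k} {..<k} = det M"
proof -
  have "{..<k} \<in> ksets k k" by (simp add: ksets_def)
  moreover have "mat k k (\<lambda>(i, j). M $$ (pick {..<k} i, pick {..<k} j)) = M"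
    using assms by (intro eq_matI) (auto simp: pick_lessThan)
  ultimately show ?thesis using compound_det[OF assms] by metis
qed

text \<open>The determinant is the single entry of the k-th compound of U A^j V. By functoriality it
  is a combination of entries of the j-th power of \<open>cmat n k A\<close> whose coefficients,
  minors of U and V, do not depend on j.\<close>

lemma umbral_det_sandwich:
  assumes A: "A \<in> carrier_mat n n" and U: "U \<in> carrier_mat k n" and V: "V \<in> carrier_mat n k"
  shows "umbral q (\<lambda>j. det (U * A ^\<^sub>m j * V)) =
    (\<Sum>b = 0..<card (ksets n k). \<Sum>a = 0..<card (ksets n k).
      compound k U {..<k} (kset_enum n k a) * compound k V (kset_enum n k b) {..<k}
      * pmat q (cmat n k A) $$ (a, b))"
proof -
  let ?d = "card (ksets n k)"
  let ?u = "\<lambda>a. compound k U {..<k} (kset_enum n k a)"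
  let ?v = "\<lambda>b. compound k V (kset_enum n k b) {..<k}"
  have k: "{..<k} \<in> ksets k k" by (simp add: ksets_def)
  have "det (U * A ^\<^sub>m j * V) = (\<Sum>b = 0..<?d. \<Sum>a = 0..<?d. ?u a * ?v b * (cmat n k A ^\<^sub>m j) $$ (a, b))" for j
  proof -
    have Aj: "A ^\<^sub>m j \<in> carrier_mat n n" using A by simp
    have UA: "U * A ^\<^sub>m j \<in> carrier_mat k n" using U Aj by simp
    have "det (U * A ^\<^sub>m j * V) = compound k (U * A ^\<^sub>m j * V) {..<k} {..<k}"
      using UA V by (intro compound_full[symmetric]) simp
    also have "\<dots> = (\<Sum>b = 0..<?d. compound k (U * A ^\<^sub>m j) {..<k} (kset_enum n k b) * ?v b)"
      by (simp add: compound_mult[OF UA V k k] sum_ksets)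
    also have "\<dots> = (\<Sum>b = 0..<?d. (\<Sum>a = 0..<?d. ?u a * compound k (A ^\<^sub>m j) (kset_enum n k a) (kset_enum n k b)) * ?v b)"
      by (intro sum.cong refl, subst compound_mult[OF U Aj k]) (auto simp: sum_ksets kset_enum_in)
    also have "\<dots> = (\<Sum>b = 0..<?d. \<Sum>a = 0..<?d. ?u a * ?v b * (cmat n k A ^\<^sub>m j) $$ (a, b))"
      by (auto simp: cmat_pow[OF A, symmetric] sum_distrib_right sum_distrib_left cmat_index algebra_simps
          intro!: sum.cong)
    finally show ?thesis .
  qed
  then show ?thesis
    by (simp add: umbral_sum umbral_cmult pmat_index[OF cmat_carrier])
qed

lemma dvd_umbral_det:
  assumes "A \<in> carrier_mat n n" "U \<in> carrier_mat k n" "V \<in> carrier_mat n k"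
    and "mat_dvd x (pmat q (cmat n k A))"
  shows "x dvd umbral q (\<lambda>j. det (U * A ^\<^sub>m j * V))"
  unfolding umbral_det_sandwich[OF assms(1-3)]
  using assms(4) by (auto simp: mat_dvd_def carrier_matD[OF cmat_carrier] intro!: dvd_sum dvd_mult)

text \<open>Comes from X^e - 1 = (X - 1)(1 + ... + X^(e-1)). It serves to pass the hypothesis on to
  powers and to isolate the factor by which a matrix with unipotent power may fail to be
  unipotent.\<close>

lemma pmat_linear_power_pow:
  assumes H: "H \<in> carrier_mat d d"
  shows "(H ^\<^sub>m e - 1\<^sub>m d) ^\<^sub>m r = pmat ([:- 1, 1:] ^ r) H * pmat (geom_poly e ^ r) H"
  unfolding pmat_monom_minus_1[OF H, symmetric] pmat_power[OF H, symmetric]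
    pmat_mult[OF H, symmetric] monom_minus_1_factor power_mult_distrib ..

lemma mat_dvd_cmat_pow:
  assumes A: "A \<in> carrier_mat n n" and "mat_dvd x (pmat ([:- 1, 1:] ^ r) (cmat n k A))"
  shows "mat_dvd x (pmat ([:- 1, 1:] ^ r) (cmat n k (A ^\<^sub>m e)))"
proof -
  let ?d = "card (ksets n k)"
  have "pmat ([:- 1, 1:] ^ r) (cmat n k (A ^\<^sub>m e)) = (cmat n k A ^\<^sub>m e - 1\<^sub>m ?d) ^\<^sub>m r"
    by (simp add: cmat_pow[OF A] pmat_power[of _ ?d] pmat_linear[of _ ?d])
  then show ?thesis
    unfolding pmat_linear_power_pow[OF cmat_carrier]
    using assms(2) by (simp add: mat_dvd_mult_left[of _ ?d ?d _ ?d])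
qed

section \<open>Exterior powers of unipotent matrices\<close>

definition diff_op :: "(nat \<Rightarrow> 'a::comm_ring_1) \<Rightarrow> nat \<Rightarrow> 'a" where
  "diff_op f = (\<lambda>j. f (Suc j) - f j)"

text \<open>Polynomial sequences, as those killed by an iterated difference. They are closed under
  sums and products, hence under determinants; this carries unipotence to exterior powers without a
  triangular form.\<close>

definition polyseq :: "(nat \<Rightarrow> 'a::comm_ring_1) \<Rightarrow> bool" where
  "polyseq f \<longleftrightarrow> (\<exists>d. (diff_op ^^ d) f = (\<lambda>_. 0))"

lemma diff_op_pow_add: "(diff_op ^^ d) (\<lambda>j. f j + g j) = (\<lambda>j. (diff_op ^^ d) f j + (diff_op ^^ d) g j)"
  by (induction d) (auto simp: diff_op_def)

lemma diff_op_pow_zero: "(diff_op ^^ d) (\<lambda>_. 0) = (\<lambda>_. 0)"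
  by (induction d) (auto simp: diff_op_def)

lemma diff_op_pow_mono: "(diff_op ^^ d) f = (\<lambda>_. 0) \<Longrightarrow> d \<le> e \<Longrightarrow> (diff_op ^^ e) f = (\<lambda>_. 0)"
proof -
  assume "(diff_op ^^ d) f = (\<lambda>_. 0)" "d \<le> e"
  moreover have "(diff_op ^^ (e - d + d)) f = (diff_op ^^ (e - d)) ((diff_op ^^ d) f)"
    by (simp only: funpow_add comp_apply)
  ultimately show ?thesis by (simp add: diff_op_pow_zero)
qed

lemma diff_op_pow_shift: "(diff_op ^^ d) (\<lambda>j. f (Suc j)) = (\<lambda>j. (diff_op ^^ d) f (Suc j))"
  by (induction d) (auto simp: diff_op_def)

text \<open>Leibniz rule: the difference of f g is a sum of two products, in each of which one
  factor needs one difference fewer, while shifts cost nothing.\<close>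

lemma diff_op_pow_mult:
  assumes "(diff_op ^^ a) f = (\<lambda>_. 0)" "(diff_op ^^ b) g = (\<lambda>_. 0)"
  shows "(diff_op ^^ (a + b)) (\<lambda>j. f j * g j) = (\<lambda>_. 0)"
  using assms
proof (induction "a + b" arbitrary: a b f g)
  case 0
  then show ?case by simp
next
  case (Suc c)
  show ?case
  proof (cases "a = 0 \<or> b = 0")
    case True
    then show ?thesis using Suc.prems diff_op_pow_zero by auto
  next
    case False
    then obtain a' b' where ab: "a = Suc a'" "b = Suc b'" by (metis not0_implies_Suc)
    have dm: "diff_op (\<lambda>j. f j * g j) = (\<lambda>j. diff_op f j * g (Suc j) + f j * diff_op g j)"
      by (auto simp: diff_op_def algebra_simps)
    have c: "c = a' + b" "c = a + b'" using Suc.hyps(2) ab by auto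
    have f: "(diff_op ^^ a') (diff_op f) = (\<lambda>_. 0)" and g: "(diff_op ^^ b') (diff_op g) = (\<lambda>_. 0)"
      using Suc.prems unfolding ab by (simp_all add: funpow_Suc_right del: funpow.simps)
    have "(diff_op ^^ b) (\<lambda>j. g (Suc j)) = (\<lambda>_. 0)"
      using Suc.prems(2) by (simp add: diff_op_pow_shift)
    then have "(diff_op ^^ (a' + b)) (\<lambda>j. diff_op f j * g (Suc j)) = (\<lambda>_. 0)"
      using f by (intro Suc.hyps(1)[OF c(1)])
    moreover have "(diff_op ^^ (a + b')) (\<lambda>j. f j * diff_op g j) = (\<lambda>_. 0)"
      using Suc.prems(1) g by (intro Suc.hyps(1)[OF c(2)])
    moreover have "a + b = Suc (a' + b)" "a + b' = a' + b" using ab by auto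
    ultimately show ?thesis
      by (simp only: funpow_Suc_right comp_apply dm diff_op_pow_add) simp
  qed
qed

lemma polyseq_const: "polyseq (\<lambda>_. c)"
  unfolding polyseq_def by (rule exI[of _ 1]) (simp add: diff_op_def)

lemma polyseq_mult: "polyseq f \<Longrightarrow> polyseq g \<Longrightarrow> polyseq (\<lambda>j. f j * g j)"
  unfolding polyseq_def using diff_op_pow_mult by blast

lemma polyseq_add:
  assumes "polyseq f" "polyseq g"
  shows "polyseq (\<lambda>j. f j + g j)"
proof -
  obtain a b where ab: "(diff_op ^^ a) f = (\<lambda>_. 0)" "(diff_op ^^ b) g = (\<lambda>_. 0)"
    using assms by (auto simp: polyseq_def)
  then have "(diff_op ^^ (a + b)) f = (\<lambda>_. 0)" "(diff_op ^^ (a + b)) g = (\<lambda>_. 0)"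
    by (auto elim: diff_op_pow_mono)
  then have "(diff_op ^^ (a + b)) (\<lambda>j. f j + g j) = (\<lambda>_. 0)" by (simp add: diff_op_pow_add)
  then show ?thesis by (auto simp: polyseq_def)
qed

lemma polyseq_sum: "(\<And>c. c \<in> S \<Longrightarrow> polyseq (f c)) \<Longrightarrow> polyseq (\<lambda>j. \<Sum>c\<in>S. f c j)"
  by (induction S rule: infinite_finite_induct) (auto simp: polyseq_const polyseq_add)

lemma polyseq_prod: "(\<And>c. c \<in> S \<Longrightarrow> polyseq (f c)) \<Longrightarrow> polyseq (\<lambda>j. \<Prod>c\<in>S. f c j)"
  by (induction S rule: infinite_finite_induct) (auto simp: polyseq_const polyseq_mult)

lemma umbral_linear_power: "umbral ([:- 1, 1:] ^ d) (\<lambda>j. f (t + j)) = (diff_op ^^ d) f t"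
proof (induction d arbitrary: f)
  case 0
  then show ?case by simp
next
  case (Suc d)
  have "umbral ([:- 1, 1:] ^ Suc d) (\<lambda>j. f (t + j)) = umbral ([:- 1, 1:] ^ d) (\<lambda>j. diff_op f (t + j))"
    unfolding power_Suc2 umbral_mult by (simp add: umbral_pCons diff_op_def)
  then show ?case by (simp add: Suc.IH funpow_swap1)
qed

lemma polyseq_det:
  assumes "\<And>i c. i < k \<Longrightarrow> c < k \<Longrightarrow> polyseq (\<lambda>j. f i c j)"
  shows "polyseq (\<lambda>j. det (mat k k (\<lambda>(i, c). f i c j)))"
proof -
  have "det (mat k k (\<lambda>(i, c). f i c j))
      = (\<Sum>s\<in>{s. s permutes {0..<k}}. signof s * (\<Prod>i = 0..<k. f i (s i) j))" for j
    by (subst det_def'[of _ k]) (auto simp: permutes_less intro!: sum.cong prod.cong)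
  then show ?thesis
    using assms by (auto intro!: polyseq_sum polyseq_mult polyseq_const polyseq_prod simp: permutes_less)
qed

text \<open>(A - 1)^M = 0 says that the M-th difference of j -> A^j vanishes. The monomial of degree
  t in the proof moves the evaluation point from 0 to t.\<close>

lemma polyseq_pow_mat:
  assumes A: "A \<in> carrier_mat n n" and "unipotent n A" and ab: "a < n" "b < n"
  shows "polyseq (\<lambda>j. (A ^\<^sub>m j) $$ (a, b))"
proof -
  obtain M where M: "(A - 1\<^sub>m n) ^\<^sub>m M = 0\<^sub>m n n" using assms(2) by (auto simp: unipotent_def)
  have "(diff_op ^^ M) (\<lambda>j. (A ^\<^sub>m j) $$ (a, b)) t = 0" for t
  proof -
    have "(diff_op ^^ M) (\<lambda>j. (A ^\<^sub>m j) $$ (a, b)) t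
        = umbral (monom 1 t * [:- 1, 1:] ^ M) (\<lambda>j. (A ^\<^sub>m j) $$ (a, b))"
      by (simp add: umbral_linear_power[symmetric] umbral_mult umbral_monom)
    also have "\<dots> = pmat (monom 1 t * [:- 1, 1:] ^ M) A $$ (a, b)"
      using pmat_index[OF A ab] by simp
    also have "pmat (monom 1 t * [:- 1, 1:] ^ M) A = 0\<^sub>m n n"
      by (simp add: pmat_mult[OF A] pmat_power[OF A] pmat_linear[OF A] pmat_monom[OF A] M
          right_mult_zero_mat[OF pow_carrier_mat[OF A]])
    finally show ?thesis using ab by simp
  qed
  then show ?thesis unfolding polyseq_def by blast
qed

text \<open>The minors of A^j are polynomial in j, and the entries of (H - 1)^M, for H the compound,
  are their M-th differences at 0.\<close>

lemma unipotent_cmat: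
  assumes A: "A \<in> carrier_mat n n" and "unipotent n A"
  shows "unipotent (card (ksets n k)) (cmat n k A)"
proof -
  let ?d = "card (ksets n k)" and ?H = "cmat n k A"
  let ?f = "\<lambda>a b j. (?H ^\<^sub>m j) $$ (a, b)"
  have "polyseq (?f a b)" if ab: "a < ?d" "b < ?d" for a b
  proof -
    let ?I = "kset_enum n k a" and ?J = "kset_enum n k b"
    note IJ = kset_enum_in[OF ab(1)] kset_enum_in[OF ab(2)]
    have "?f a b = (\<lambda>j. det (mat k k (\<lambda>(i, c). (A ^\<^sub>m j) $$ (pick ?I i, pick ?J c))))"
      using ab compound_det[OF pow_carrier_mat[OF A] IJ]
      by (simp add: cmat_pow[OF A, symmetric] cmat_index)
    then show ?thesis
      using polyseq_pow_mat[OF assms] pick_less[OF IJ(1)] pick_less[OF IJ(2)]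
      by (simp add: polyseq_det)
  qed
  then obtain D where D: "\<And>a b. a < ?d \<Longrightarrow> b < ?d \<Longrightarrow> (diff_op ^^ D a b) (?f a b) = (\<lambda>_. 0)"
    unfolding polyseq_def by metis
  define M where "M = (\<Sum>a<?d. \<Sum>b<?d. D a b)"
  have "(?H - 1\<^sub>m ?d) ^\<^sub>m M = pmat ([:- 1, 1:] ^ M) ?H"
    by (simp add: pmat_power[of _ ?d] pmat_linear[of _ ?d])
  also have "\<dots> = 0\<^sub>m ?d ?d"
  proof (rule eq_matI)
    fix a b assume "a < dim_row (0\<^sub>m ?d ?d)" "b < dim_col (0\<^sub>m ?d ?d)"
    then have ab: "a < ?d" "b < ?d" by auto
    have "D a b \<le> (\<Sum>b<?d. D a b)" using ab by (intro member_le_sum) auto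
    also have "\<dots> \<le> M" unfolding M_def using ab by (intro member_le_sum) auto
    finally have "(diff_op ^^ M) (?f a b) = (\<lambda>_. 0)" using D[OF ab] diff_op_pow_mono by blast
    then show "pmat ([:- 1, 1:] ^ M) ?H $$ (a, b) = 0\<^sub>m ?d ?d $$ (a, b)"
      using umbral_linear_power[of M "?f a b" 0] ab by (simp add: pmat_index[of _ ?d])
  qed (simp_all add: carrier_matD[OF cmat_carrier])
  finally show ?thesis unfolding unipotent_def by blast
qed

section \<open>Matrices over a discrete valuation ring\<close>

lemma mat_vec_smult:
  fixes A :: "'a::comm_ring_1 mat"
  assumes "A \<in> carrier_mat nr nc" "v \<in> carrier_vec nc"
  shows "A *\<^sub>v (c \<cdot>\<^sub>v v) = c \<cdot>\<^sub>v (A *\<^sub>v v)"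
  by (rule eq_vecI) (use assms in \<open>auto simp: scalar_prod_def sum_distrib_left algebra_simps intro!: sum.cong\<close>)

text \<open>The lattice as a module over the polynomial ring, with X acting as A.\<close>

definition act :: "'a::comm_ring_1 mat \<Rightarrow> 'a poly \<Rightarrow> 'a vec \<Rightarrow> 'a vec" where
  "act A q v = pmat q A *\<^sub>v v"

lemma act_carrier [simp]: "A \<in> carrier_mat n n \<Longrightarrow> act A q v \<in> carrier_vec n"
  by (rule carrier_vecI) (simp add: act_def)

context
  fixes A :: "'a::comm_ring_1 mat" and n :: nat
  assumes A: "A \<in> carrier_mat n n"
begin

lemma act_add: "v \<in> carrier_vec n \<Longrightarrow> act A (p + q) v = act A p v + act A q v"
  by (simp add: act_def pmat_add[OF A] add_mult_distrib_mat_vec[of _ n n] A)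

lemma act_smult: "v \<in> carrier_vec n \<Longrightarrow> act A (smult c q) v = c \<cdot>\<^sub>v act A q v"
  by (rule eq_vecI)
    (use A in \<open>auto simp: act_def pmat_smult[OF A] scalar_prod_def sum_distrib_left mult.assoc intro!: sum.cong\<close>)

lemma act_mult: "v \<in> carrier_vec n \<Longrightarrow> act A (p * q) v = act A p (act A q v)"
  using A by (simp add: act_def pmat_mult[OF A] assoc_mult_mat_vec[of _ n n _ n])

lemma act_1: "v \<in> carrier_vec n \<Longrightarrow> act A 1 v = v"
  by (simp add: act_def pmat_1[OF A])

lemma act_monom: "act A (monom 1 e) v = A ^\<^sub>m e *\<^sub>v v"
  by (simp add: act_def pmat_monom[OF A])

lemma act_vec_add: "v \<in> carrier_vec n \<Longrightarrow> w \<in> carrier_vec n \<Longrightarrow> act A q (v + w) = act A q v + act A q w"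
  using A by (simp add: act_def mult_add_distrib_mat_vec[of _ n n])

lemma act_vec_smult: "v \<in> carrier_vec n \<Longrightarrow> act A q (c \<cdot>\<^sub>v v) = c \<cdot>\<^sub>v act A q v"
  using A by (simp add: act_def mat_vec_smult[of _ n n])

lemma act_vec_zero: "act A q (0\<^sub>v n) = 0\<^sub>v n"
  by (rule eq_vecI) (use A in \<open>auto simp: act_def scalar_prod_def\<close>)

end

definition vec_dvd :: "'a::comm_ring_1 \<Rightarrow> 'a vec \<Rightarrow> bool" where
  "vec_dvd x v \<longleftrightarrow> (\<forall>a<dim_vec v. x dvd v $ a)"

lemma vec_dvd_mult_mat: "v \<in> carrier_vec (dim_col M) \<Longrightarrow> vec_dvd x v \<Longrightarrow> vec_dvd x (M *\<^sub>v v)"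
  by (auto simp: vec_dvd_def scalar_prod_def intro!: dvd_sum dvd_mult)

lemma vec_dvd_act: "A \<in> carrier_mat n n \<Longrightarrow> v \<in> carrier_vec n \<Longrightarrow> vec_dvd x v \<Longrightarrow> vec_dvd x (act A q v)"
  unfolding act_def by (intro vec_dvd_mult_mat) auto

lemma vec_dvd_smult: "vec_dvd x (x \<cdot>\<^sub>v v)"
  by (auto simp: vec_dvd_def)

lemma vec_dvdE:
  assumes "vec_dvd x v" "v \<in> carrier_vec n"
  obtains w where "w \<in> carrier_vec n" "v = x \<cdot>\<^sub>v w"
proof -
  from assms have "\<forall>a<n. \<exists>y. v $ a = x * y" by (auto simp: vec_dvd_def dvd_def)
  then obtain f where f: "\<And>a. a < n \<Longrightarrow> v $ a = x * f a" by metis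
  show ?thesis by (rule that[of "vec n f"]) (use f assms in \<open>auto intro!: eq_vecI\<close>)
qed

lemma smult_vec_cancel:
  fixes x :: "'a::idom"
  assumes "x \<noteq> 0" "v \<in> carrier_vec n" "w \<in> carrier_vec n" "x \<cdot>\<^sub>v v = x \<cdot>\<^sub>v w"
  shows "v = w"
proof (rule eq_vecI)
  fix i assume "i < dim_vec w"
  moreover have "(x \<cdot>\<^sub>v v) $ i = (x \<cdot>\<^sub>v w) $ i" using assms(4) by simp
  ultimately have "x * v $ i = x * w $ i" using assms(2,3) by simp
  then show "v $ i = w $ i" using assms(1) by simp
qed (use assms in auto)

lemma synthetic_division_1:
  obtains s where "q = [:poly q 1:] + [:- 1, 1:] * (s :: 'a::comm_ring_1 poly)"
proof -
  have "poly (q - [:poly q 1:]) 1 = 0" by simp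
  then have "[:- 1, 1:] dvd q - [:poly q 1:]" by (simp only: poly_eq_0_iff_dvd)
  then obtain s where "q - [:poly q 1:] = [:- 1, 1:] * s" by (rule dvdE)
  then have "q = [:poly q 1:] + [:- 1, 1:] * s" by (simp add: diff_eq_eq add.commute)
  then show ?thesis by (rule that)
qed

context ladic_ring
begin

text \<open>Modulo \<open>p\<close> the matrix H - 1 is nilpotent, so q(H) is q(1) plus a nilpotent,
  which is injective when q(1) is a unit.\<close>

lemma pmat_injective_mod:
  assumes H: "H \<in> carrier_mat d d" and H1: "mat_dvd \<pi> (pmat ([:- 1, 1:] ^ r) H)"
    and q: "\<not> \<pi> dvd poly q 1"
    and Y: "Y \<in> carrier_mat d c" and "pmat q H * Y = 0\<^sub>m d c"
  shows "mat_dvd \<pi> Y"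
proof -
  obtain s where s: "q = [:poly q 1:] + [:- 1, 1:] * s" by (rule synthetic_division_1)
  define X where "X = [:- 1, 1 :: 'a:]"
  \<comment> \<open>\<open>X\<close> stands for X - 1. As q(1) = q - (X - 1) s, the constant q(1)^r
    lies in the ideal generated by q and (X - 1)^r; on Y the first generator acts as 0, the second
    gives multiples of \<open>p\<close>.\<close>
  have "[:poly q 1:] - X * (- s) = q" unfolding X_def by (subst (2) s) simp
  then have "q dvd [:poly q 1:] ^ r - (X * (- s)) ^ r"
    using power_diff_sumr2[of "[:poly q 1:]" r "X * (- s)"] by simp
  then obtain t where "[:poly q 1:] ^ r - (X * (- s)) ^ r = q * t" by (rule dvdE)
  then have "[:poly q 1:] ^ r = X ^ r * (- s) ^ r + t * q"
    unfolding power_mult_distrib by (simp add: diff_eq_eq mult.commute add.commute)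
  moreover have "[:poly q 1:] ^ r = smult (poly q 1 ^ r) 1"
    by (simp add: poly_const_pow one_pCons)
  ultimately have pe: "smult (poly q 1 ^ r) 1 = [:- 1, 1:] ^ r * (- s) ^ r + t * q"
    by (simp only: X_def)
  have "poly q 1 ^ r \<cdot>\<^sub>m Y = pmat (smult (poly q 1 ^ r) 1) H * Y"
    unfolding pmat_smult[OF H] pmat_1[OF H]
    using Y by (simp add: mult_smult_assoc_mat[of _ d d _ c])
  also have "\<dots> = pmat ([:- 1, 1:] ^ r * (- s) ^ r) H * Y + pmat (t * q) H * Y"
    unfolding pe pmat_add[OF H] using H Y by (intro add_mult_distrib_mat[of _ d d _ _ c]) auto
  also have "\<dots> = pmat ([:- 1, 1:] ^ r) H * (pmat ((- s) ^ r) H * Y) + pmat t H * (pmat q H * Y)"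
    using H Y by (simp add: pmat_mult[OF H] assoc_mult_mat[of _ d d _ d _ c])
  also have "\<dots> = pmat ([:- 1, 1:] ^ r) H * (pmat ((- s) ^ r) H * Y)"
    using H Y assms(5) by (simp add: right_mult_zero_mat[of _ d d] right_add_zero_mat[of _ d c] mult_carrier_mat[of _ d d _ c])
  finally have e: "poly q 1 ^ r \<cdot>\<^sub>m Y = pmat ([:- 1, 1:] ^ r) H * (pmat ((- s) ^ r) H * Y)" .
  have "mat_dvd \<pi> (poly q 1 ^ r \<cdot>\<^sub>m Y)"
    unfolding e using H Y H1 by (intro mat_dvd_mult_left[of _ d d _ c]) auto
  then show ?thesis using q unfolding mat_dvd_def by (auto simp: pi_prime pi_prime_power)
qed

text \<open>A solution divisible by \<open>p\<close> may be divided by \<open>p\<close> and remains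
  a solution, so \<open>pmat_injective_mod\<close> applies again and again.\<close>

lemma pmat_injective:
  assumes H: "H \<in> carrier_mat d d" and H1: "mat_dvd \<pi> (pmat ([:- 1, 1:] ^ r) H)"
    and q: "\<not> \<pi> dvd poly q 1"
    and Y: "Y \<in> carrier_mat d c" and "pmat q H * Y = 0\<^sub>m d c"
  shows "Y = 0\<^sub>m d c"
proof (rule eq_matI)
  have *: "mat_dvd (\<pi> ^ s) Y" for s
    using Y assms(5)
  proof (induction s arbitrary: Y)
    case 0
    then show ?case by (simp add: mat_dvd_def)
  next
    case (Suc s)
    have "mat_dvd \<pi> Y" by (rule pmat_injective_mod[OF H H1 q Suc.prems])
    then have "\<forall>a<d. \<forall>b<c. \<exists>y. Y $$ (a, b) = \<pi> * y"
      using Suc.prems(1) by (auto simp: mat_dvd_def dvd_def)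
    then obtain f where f: "\<And>a b. a < d \<Longrightarrow> b < c \<Longrightarrow> Y $$ (a, b) = \<pi> * f a b" by metis
    define Z where "Z = mat d c (\<lambda>(a, b). f a b)"
    have Z: "Z \<in> carrier_mat d c" by (simp add: Z_def)
    have YZ: "Y = \<pi> \<cdot>\<^sub>m Z" using f Suc.prems(1) by (intro eq_matI) (auto simp: Z_def)
    have "\<pi> \<cdot>\<^sub>m (pmat q H * Z) = 0\<^sub>m d c"
      using Suc.prems(2) H Z unfolding YZ by (simp add: mult_smult_distrib[of _ d d _ c])
    then have "\<forall>a<d. \<forall>b<c. \<pi> * (pmat q H * Z) $$ (a, b) = 0"
      using H Z by (auto simp: mat_eq_iff)
    then have "pmat q H * Z = 0\<^sub>m d c"
      using H Z p_nonzero by (intro eq_matI) auto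
    then have "mat_dvd (\<pi> ^ s) Z" by (rule Suc.IH[OF Z])
    then show ?case unfolding YZ mat_dvd_def by auto
  qed
  fix a b assume "a < dim_row (0\<^sub>m d c)" "b < dim_col (0\<^sub>m d c)"
  then have "Y $$ (a, b) = 0"
    using * Y by (intro pi_power_dvd_imp_zero) (auto simp: mat_dvd_def)
  then show "Y $$ (a, b) = 0\<^sub>m d c $$ (a, b)" using \<open>a < _\<close> \<open>b < _\<close> by simp
qed (use Y in auto)

text \<open>(H^c - 1)^M is (1 + ... + H^(c-1))^M times (H - 1)^M, and the first factor can be
  cancelled: its polynomial has the value c^M at 1, a unit.\<close>

lemma unipotent_of_coprime_power:
  assumes H: "H \<in> carrier_mat d d" and H1: "mat_dvd \<pi> (pmat ([:- 1, 1:] ^ r) H)"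
    and "\<not> p dvd c" and "unipotent d (H ^\<^sub>m c)"
  shows "unipotent d H"
proof -
  obtain M where M: "(H ^\<^sub>m c - 1\<^sub>m d) ^\<^sub>m M = 0\<^sub>m d d" using assms(4) by (auto simp: unipotent_def)
  have eq: "pmat (geom_poly c ^ M) H * pmat ([:- 1, 1:] ^ M) H = 0\<^sub>m d d"
    using pmat_linear_power_pow[OF H, of c M] M
    by (simp add: pmat_mult[OF H, symmetric] mult.commute)
  have nd: "\<not> \<pi> dvd poly (geom_poly c ^ M) 1"
    using assms(3) pi_dvd_of_nat[of c] unfolding poly_power poly_geom_poly_1 pi_prime_power by blast
  have "pmat ([:- 1, 1:] ^ M) H = 0\<^sub>m d d"
    by (rule pmat_injective[OF H H1 nd pmat_carrier[OF H] eq])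
  then show ?thesis
    unfolding unipotent_def by (auto simp: pmat_power[OF H] pmat_linear[OF H])
qed

text \<open>By Cramer's rule, putting P z in column \<open>a\<close> multiplies the determinant by
  the unit z_a. As s <= a, a swap then brings it to position \<open>s\<close> without touching
  earlier columns.\<close>

lemma replace_basis_column:
  assumes P: "P \<in> carrier_mat n n" and dP: "det P dvd (1::'a)" and z: "z \<in> carrier_vec n"
    and sa: "s \<le> a" "a < n" "z $ a dvd 1"
  obtains P' where "P' \<in> carrier_mat n n" "det P' dvd 1" "\<And>b. b < s \<Longrightarrow> col P' b = col P b"
    "col P' s = P *\<^sub>v z"
proof -
  define R where "R = replace_col P (P *\<^sub>v z) a"
  have R: "R \<in> carrier_mat n n" using P by (simp add: R_def replace_col_def)
  have "det R = z $ a * det P" unfolding R_def by (rule cramer_lemma_mat[OF P z sa(2)])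
  then have dR: "det R dvd 1" using dP sa(3) by (simp add: is_unit_mult_iff)
  have cR: "col R b = (if b = a then P *\<^sub>v z else col P b)" if "b < n" for b
    using that P by (intro eq_vecI) (auto simp: R_def replace_col_def)
  show ?thesis
  proof (cases "s = a")
    case True
    then show ?thesis using R dR cR sa(2) by (intro that[of R]) auto
  next
    case False
    have S: "swapcols s a R \<in> carrier_mat n n" using R by (simp add: mat_swapcols_def)
    have cS: "col (swapcols s a R) b = (if b = s then col R a else if b = a then col R s else col R b)"
      if "b < n" for b
      using that R sa False by (intro eq_vecI) (auto simp: mat_swapcols_def)
    have "det (swapcols s a R) = - det R" by (rule det_swapcols[OF _ _ False R]) (use sa in auto)
    then show ?thesis using S dR cS cR sa False by (intro that[of "swapcols s a R"]) auto
  qed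
qed

lemma unit_det_inverse:
  assumes P: "P \<in> carrier_mat n n" and "det P dvd (1::'a)"
  obtains Q where "Q \<in> carrier_mat n n" "P * Q = 1\<^sub>m n" "Q * P = 1\<^sub>m n"
proof -
  obtain u where u: "1 = det P * u" using assms(2) by (rule dvdE)
  show ?thesis
  proof (rule that[of "u \<cdot>\<^sub>m adj_mat P"])
    show "u \<cdot>\<^sub>m adj_mat P \<in> carrier_mat n n" using adj_mat(1)[OF P] by simp
    have "u \<cdot>\<^sub>m (det P \<cdot>\<^sub>m 1\<^sub>m n) = 1\<^sub>m n" using u by (intro eq_matI) (auto simp: mult.commute)
    then show "P * (u \<cdot>\<^sub>m adj_mat P) = 1\<^sub>m n" "u \<cdot>\<^sub>m adj_mat P * P = 1\<^sub>m n"
      using adj_mat[OF P] P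
      by (simp_all add: mult_smult_distrib[of _ n n _ n] mult_smult_assoc_mat[of _ n n _ n])
  qed
qed

end

section \<open>A saturated cyclotomic sublattice\<close>

lemma smult_zero_vec_right: "c \<cdot>\<^sub>v 0\<^sub>v n = (0\<^sub>v n :: 'a::comm_ring_1 vec)"
  by (rule eq_vecI) auto

lemma vec_dvd_add_iff:
  "v \<in> carrier_vec n \<Longrightarrow> w \<in> carrier_vec n \<Longrightarrow> vec_dvd x v \<Longrightarrow> vec_dvd x (v + w) \<longleftrightarrow> vec_dvd x w"
  by (auto simp: vec_dvd_def dvd_add_right_iff)

lemma vec_dvd_smult_left: "x dvd c \<Longrightarrow> vec_dvd x (c \<cdot>\<^sub>v v)"
  by (auto simp: vec_dvd_def)

context ladic_ring
begin

text \<open>If A is not unipotent, (A - 1)^M has a nonzero column, yet the M-th power of the norm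
  polynomial kills it. The last nonzero vector under repeated application of the norm polynomial is
  the one sought.\<close>

lemma exists_kernel_vector:
  assumes A: "A \<in> carrier_mat n n" and Ap: "unipotent n (A ^\<^sub>m p)" and nu: "\<not> unipotent n (A :: 'a mat)"
  obtains y where "y \<in> carrier_vec n" "y \<noteq> 0\<^sub>v n" "act A (geom_poly p) y = 0\<^sub>v n"
proof -
  obtain M where M: "(A ^\<^sub>m p - 1\<^sub>m n) ^\<^sub>m M = 0\<^sub>m n n" using Ap by (auto simp: unipotent_def)
  define X where "X = pmat ([:- 1, 1:] ^ M) A"
  have X: "X \<in> carrier_mat n n" using A by (simp add: X_def)
  have "X \<noteq> 0\<^sub>m n n"
    using nu unfolding X_def unipotent_def by (auto simp: pmat_power[OF A] pmat_linear[OF A])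
  then obtain b where b: "b < n" "col X b \<noteq> 0\<^sub>v n"
    using X mat_col_eqI[of "0\<^sub>m n n" X] by auto
  define x where "x = col X b"
  have x: "x \<in> carrier_vec n" "x \<noteq> 0\<^sub>v n" using X b by (auto simp: x_def)
  have "pmat (geom_poly p ^ M) A * X = 0\<^sub>m n n"
    unfolding X_def pmat_mult[OF A, symmetric]
    using pmat_linear_power_pow[OF A, of p M] M by (simp add: pmat_mult[OF A, symmetric] mult.commute)
  then have "act A (geom_poly p ^ M) x = 0\<^sub>v n"
    using b(1) X A unfolding x_def act_def by (metis col_mult2 col_zero pmat_carrier)
  then have ex: "\<exists>K. act A (geom_poly p ^ K) x = 0\<^sub>v n" by blast
  define K where "K = (LEAST K. act A (geom_poly p ^ K) x = 0\<^sub>v n)"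
  have K: "act A (geom_poly p ^ K) x = 0\<^sub>v n" unfolding K_def by (rule LeastI_ex[OF ex])
  then have "K \<noteq> 0" using x act_1[OF A] by (cases K) auto
  then obtain K' where K': "K = Suc K'" by (metis not0_implies_Suc)
  have "act A (geom_poly p ^ K') x \<noteq> 0\<^sub>v n"
    using not_less_Least[of K' "\<lambda>K. act A (geom_poly p ^ K) x = 0\<^sub>v n"] K' unfolding K_def by simp
  moreover have "act A (geom_poly p) (act A (geom_poly p ^ K') x) = 0\<^sub>v n"
    using K unfolding K' by (simp add: act_mult[OF A x(1)])
  ultimately show ?thesis using that act_carrier[OF A] by blast
qed

text \<open>The kernel \<open>L\<close> of the norm polynomial satisfies \<open>(A - 1)\<^sup>p\<^sup>-\<^sup>1 L = p L\<close>, so a vector of \<open>L\<close>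
  outside \<open>(A - 1) L\<close> generates a copy of \<open>\<int>\<^sub>p[\<zeta>]\<close> that is saturated in the lattice.\<close>

lemma exists_saturated_vector:
  assumes A: "A \<in> carrier_mat n n" and "p \<noteq> 2"
    and y: "y \<in> carrier_vec n" "y \<noteq> 0\<^sub>v n" "act A (geom_poly p) y = (0\<^sub>v n :: 'a vec)"
  obtains v where "v \<in> carrier_vec n" "act A (geom_poly p) v = 0\<^sub>v n"
    "\<not> vec_dvd \<pi> (act A ([:- 1, 1:] ^ (p - 2)) v)"
proof -
  have p2: "p > 2" using prime_p assms(2) prime_gt_1_nat[OF prime_p] by linarith
  let ?X = "[:- 1, 1 :: 'a:]"
  define L where "L = {y \<in> carrier_vec n. act A (geom_poly p) y = 0\<^sub>v n}"
  obtain q :: "'a poly" where q: "?X ^ (p - 1) = geom_poly p + smult \<pi> q"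
    using linear_power_prime[OF prime_p assms(2)] by blast
  have "poly (geom_poly p + smult \<pi> q) 1 = 0" using p2 unfolding q[symmetric] by simp
  then have "\<pi> * (1 + poly q 1) = 0" by (simp add: poly_geom_poly_1 algebra_simps)
  then have q1: "poly q 1 = - 1" using p_nonzero by (simp add: eq_neg_iff_add_eq_0 add.commute)
  have actL: "act A r w \<in> L" if "w \<in> L" for r w
    using that act_vec_zero[OF A, of r] act_mult[OF A, of w r "geom_poly p"]
      act_mult[OF A, of w "geom_poly p" r] A by (simp add: L_def mult.commute)
  have top: "act A (?X ^ (p - 1)) w = \<pi> \<cdot>\<^sub>v act A q w" if "w \<in> L" for w
    using that A unfolding q by (simp add: L_def act_add[OF A] act_smult[OF A] left_zero_vec[of _ n])
  obtain v where v: "v \<in> L" "\<And>w. w \<in> L \<Longrightarrow> v \<noteq> act A ?X w"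
  \<comment> \<open>If A - 1 mapped L onto itself, so would (A - 1)^(p-1), whose values on L lie in
    p L; then all vectors of L, including y, would be divisible by every power of p.\<close>
  proof (rule ccontr)
    assume "\<not> thesis"
    with that have *: "\<exists>w\<in>L. v = act A ?X w" if "v \<in> L" for v using that by metis
    have **: "\<exists>w\<in>L. v = act A (?X ^ j) w" if "v \<in> L" for v j
      using that
    proof (induction j arbitrary: v)
      case 0
      then show ?case using act_1[OF A] by (auto simp: L_def)
    next
      case (Suc j)
      then obtain w where w: "w \<in> L" "v = act A (?X ^ j) w" by blast
      then obtain u where "u \<in> L" "w = act A ?X u" using * by blast
      then have "v = act A (?X ^ Suc j) u"
        using w act_mult[OF A, of u "?X ^ j" ?X] unfolding power_Suc2 by (simp add: L_def)
      then show ?case using \<open>u \<in> L\<close> by blast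
    qed
    have div: "\<exists>w\<in>L. v = \<pi> \<cdot>\<^sub>v w" if "v \<in> L" for v
      using **[OF that, of "p - 1"] top actL by metis
    have "vec_dvd (\<pi> ^ s) v" if "v \<in> L" for v s
      using that
    proof (induction s arbitrary: v)
      case 0
      then show ?case by (simp add: vec_dvd_def)
    next
      case (Suc s)
      then obtain w where "w \<in> L" "v = \<pi> \<cdot>\<^sub>v w" using div by blast
      then show ?case using Suc.IH[of w] by (auto simp: vec_dvd_def)
    qed
    then have "\<pi> ^ s dvd y $ a" if "a < n" for s a
      using y that by (auto simp: vec_dvd_def L_def)
    then have "y = 0\<^sub>v n" using y(1) pi_power_dvd_imp_zero by (intro eq_vecI) auto
    with y show False by simp
  qed
  have vc: "v \<in> carrier_vec n" using v by (simp add: L_def)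
  \<comment> \<open>If (A - 1)^(p-2) v = p w, then w lies in L, and applying A - 1 and cancelling p
    gives q(A) v = (A - 1) w. As q(1) = -1, the polynomial 1 + q is a multiple of X - 1, so v would
    lie in (A - 1) L.\<close>
  have "\<not> vec_dvd \<pi> (act A (?X ^ (p - 2)) v)"
  proof
    assume "vec_dvd \<pi> (act A (?X ^ (p - 2)) v)"
    then obtain w where w: "w \<in> carrier_vec n" "act A (?X ^ (p - 2)) v = \<pi> \<cdot>\<^sub>v w"
      using act_carrier[OF A] by (rule vec_dvdE)
    have "\<pi> \<cdot>\<^sub>v act A (geom_poly p) w = act A (geom_poly p) (act A (?X ^ (p - 2)) v)"
      using w by (simp add: act_vec_smult[OF A])
    also have "\<dots> = \<pi> \<cdot>\<^sub>v 0\<^sub>v n" using actL[OF v(1)] by (simp add: L_def smult_zero_vec_right)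
    finally have "act A (geom_poly p) w = 0\<^sub>v n"
      by (rule smult_vec_cancel[OF p_nonzero act_carrier[OF A] zero_carrier_vec])
    then have wL: "w \<in> L" using w by (simp add: L_def)
    have "p - 1 = Suc (p - 2)" using p2 by simp
    then have "act A (?X ^ (p - 1)) v = act A ?X (act A (?X ^ (p - 2)) v)"
      using act_mult[OF A vc, of ?X "?X ^ (p - 2)"] by simp
    then have "\<pi> \<cdot>\<^sub>v act A q v = \<pi> \<cdot>\<^sub>v act A ?X w"
      using w top[OF v(1)] by (simp add: act_vec_smult[OF A])
    then have qv: "act A q v = act A ?X w"
      by (rule smult_vec_cancel[OF p_nonzero act_carrier[OF A] act_carrier[OF A]])
    obtain s where "q = [:poly q 1:] + ?X * s" by (rule synthetic_division_1)
    then have s: "1 + q = ?X * s" using q1 by (simp add: one_pCons)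
    have "v + act A q v = act A ?X (act A s v)"
      using act_mult[OF A vc, of ?X s] unfolding s[symmetric] act_add[OF A vc] act_1[OF A vc] .
    then have "v + act A ?X w = act A ?X (act A s v)" by (simp add: qv)
    moreover have "act A ?X ((act A s v) + (- 1) \<cdot>\<^sub>v w) = act A ?X (act A s v) + (- 1) \<cdot>\<^sub>v act A ?X w"
      using A w by (simp add: act_vec_add[OF A] act_vec_smult[OF A])
    ultimately have "act A ?X ((act A s v) + (- 1) \<cdot>\<^sub>v w) = v + act A ?X w + (- 1) \<cdot>\<^sub>v act A ?X w"
      by simp
    also have "\<dots> = v"
      using vc act_carrier[OF A, of ?X w] by (intro eq_vecI) auto
    finally have "v = act A ?X ((act A s v) + (- 1) \<cdot>\<^sub>v w)" ..
    moreover have "(act A s v) + (- 1) \<cdot>\<^sub>v w \<in> L"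
      using actL[OF v(1), of s] wL A
      by (simp add: L_def act_vec_add[OF A] act_vec_smult[OF A] smult_zero_vec_right)
    ultimately show False using v(2) by blast
  qed
  then show ?thesis using that v by (auto simp: L_def)
qed

text \<open>Modulo \<open>p\<close>, v generates a copy of F_p[X]/(X - 1)^(p-1), where no nonzero
  polynomial of degree at most p - 2 vanishes. For e = 0 this makes v, A v, ..., A^(p-2) v
  independent modulo \<open>p\<close>; \<open>e\<close> counts the factors X - 1 split off in the
  induction.\<close>

lemma monic_act_not_dvd:
  assumes A: "A \<in> carrier_mat n n" and "p \<noteq> 2"
    and v: "v \<in> carrier_vec n" "act A (geom_poly p) v = (0\<^sub>v n :: 'a vec)"
      "\<not> vec_dvd \<pi> (act A ([:- 1, 1:] ^ (p - 2)) v)"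
    and "degree c + e \<le> p - 2" "lead_coeff c = 1"
  shows "\<not> vec_dvd \<pi> (act A (c * [:- 1, 1:] ^ e) v)"
  using assms(6-7)
proof (induction "degree c" arbitrary: c e)
  case 0
  then obtain a where "c = [:a:]" by (metis degree_eq_zeroE)
  with 0 have "c = 1" by (simp add: one_pCons)
  have "[:- 1, 1 :: 'a:] ^ (p - 2) = [:- 1, 1:] ^ (p - 2 - e) * [:- 1, 1:] ^ e"
    using 0 by (metis add_0 le_add_diff_inverse2 power_add)
  then have "act A ([:- 1, 1:] ^ (p - 2)) v = act A ([:- 1, 1:] ^ (p - 2 - e)) (act A ([:- 1, 1:] ^ e) v)"
    by (simp only: act_mult[OF A v(1)])
  then show ?case
    using v(3) vec_dvd_act[OF A act_carrier[OF A]] unfolding \<open>c = 1\<close> mult_1 by metis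
next
  case (Suc s)
  let ?X = "[:- 1, 1 :: 'a:]"
  have p2: "p > 2" using prime_p assms(2) prime_gt_1_nat[OF prime_p] by linarith
  obtain q :: "'a poly" where q: "?X ^ (p - 1) = geom_poly p + smult \<pi> q"
    using linear_power_prime[OF prime_p assms(2)] by blast
  have top: "act A (?X ^ (p - 1)) v = \<pi> \<cdot>\<^sub>v act A q v"
    using v A unfolding q by (simp add: act_add[OF A] act_smult[OF A] left_zero_vec[of _ n])
  obtain c1 where c1: "c = [:poly c 1:] + ?X * c1" by (rule synthetic_division_1)
  have "c1 \<noteq> 0" using c1 Suc.hyps(2) by (metis add.right_neutral degree_pCons_0 mult_zero_right nat.distinct(1))
  then have d: "degree (?X * c1) = Suc (degree c1)" by (subst degree_mult_eq) auto
  then have dc: "degree c = Suc (degree c1)" by (subst c1, subst degree_add_eq_right) auto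
  have "lead_coeff c = lead_coeff (?X * c1)"
    unfolding dc d by (subst c1) simp
  also have "\<dots> = lead_coeff ?X * lead_coeff c1" by (rule lead_coeff_mult)
  also have "lead_coeff ?X = 1" by simp
  finally have lc: "lead_coeff c1 = 1" using Suc.prems(2) by simp
  show ?case
  proof
    assume *: "vec_dvd \<pi> (act A (c * ?X ^ e) v)"
    show False
    proof (cases "\<pi> dvd poly c 1")
      \<comment> \<open>Modulo \<open>p\<close> the constant c(1) drops out, leaving c1 with one
        more factor X - 1.\<close>
      case True
      have "c * ?X ^ e = smult (poly c 1) (?X ^ e) + c1 * ?X ^ Suc e"
        by (subst c1) (simp add: ring_distribs)
      then have "act A (c * ?X ^ e) v = poly c 1 \<cdot>\<^sub>v act A (?X ^ e) v + act A (c1 * ?X ^ Suc e) v"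
        by (simp only: act_add[OF A v(1)] act_smult[OF A v(1)])
      moreover have "\<not> vec_dvd \<pi> (act A (c1 * ?X ^ Suc e) v)"
        using Suc.hyps(2) Suc.prems dc lc by (intro Suc.hyps(1)) auto
      ultimately show False
        using * vec_dvd_add_iff[OF _ act_carrier[OF A] vec_dvd_smult_left[OF True]] A
        by (metis act_carrier smult_carrier_vec)
    next
      \<comment> \<open>Multiplying by (X - 1)^(p-2-e) isolates the unit multiple c(1) (A - 1)^(p-2)
        v, since the other term contains (A - 1)^(p-1), which is divisible by \<open>p\<close> on
        v.\<close>
      case False
      have "?X ^ (p - 2 - e) * (c * ?X ^ e) = ?X ^ (p - 2) * c"
      proof -
        have "p - 2 = (p - 2 - e) + e" using Suc.prems(1) by simp
        then have "?X ^ (p - 2) = ?X ^ (p - 2 - e) * ?X ^ e" by (metis power_add)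
        then show ?thesis by (simp only: ac_simps)
      qed
      also have "\<dots> = smult (poly c 1) (?X ^ (p - 2)) + c1 * ?X ^ (p - 1)"
      proof -
        have "p - 1 = Suc (p - 2)" using p2 by simp
        then have "?X ^ (p - 2) * ([:poly c 1:] + ?X * c1)
            = [:poly c 1:] * ?X ^ (p - 2) + c1 * ?X ^ (p - 1)"
          by (simp only: power_Suc ring_distribs ac_simps)
        then show ?thesis using c1 by simp
      qed
      finally have "act A (?X ^ (p - 2 - e)) (act A (c * ?X ^ e) v)
          = poly c 1 \<cdot>\<^sub>v act A (?X ^ (p - 2)) v + act A c1 (\<pi> \<cdot>\<^sub>v act A q v)"
        by (simp only: act_add[OF A v(1)] act_smult[OF A v(1)] act_mult[OF A v(1), symmetric] top[symmetric])
      moreover have "vec_dvd \<pi> (act A (?X ^ (p - 2 - e)) (act A (c * ?X ^ e) v))"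
        by (rule vec_dvd_act[OF A act_carrier[OF A] *])
      moreover have "vec_dvd \<pi> (act A c1 (\<pi> \<cdot>\<^sub>v act A q v))"
        by (rule vec_dvd_act[OF A _ vec_dvd_smult]) (simp add: A)
      ultimately have "vec_dvd \<pi> (poly c 1 \<cdot>\<^sub>v act A (?X ^ (p - 2)) v)"
        using vec_dvd_add_iff[of "act A c1 (\<pi> \<cdot>\<^sub>v act A q v)" n] A
        by (metis act_carrier smult_carrier_vec comm_add_vec)
      then have "vec_dvd \<pi> (act A (?X ^ (p - 2)) v)"
        using False unfolding vec_dvd_def by (auto simp: pi_prime)
      with v(3) show False by simp
    qed
  qed
qed

end

section \<open>Bases adapted to an operator\<close>

lemma act_index:
  assumes A: "A \<in> carrier_mat n n" and v: "v \<in> carrier_vec n" and i: "i < n"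
  shows "act A q v $ i = umbral q (\<lambda>j. (A ^\<^sub>m j *\<^sub>v v) $ i)"
proof -
  have "act A q v $ i = (\<Sum>c = 0..<n. v $ c * umbral q (\<lambda>j. (A ^\<^sub>m j) $$ (i, c)))"
    using assms by (auto simp: act_def scalar_prod_def pmat_index mult.commute intro!: sum.cong)
  also have "\<dots> = umbral q (\<lambda>j. \<Sum>c = 0..<n. v $ c * (A ^\<^sub>m j) $$ (i, c))"
    by (simp add: umbral_sum umbral_cmult)
  also have "(\<lambda>j. \<Sum>c = 0..<n. v $ c * (A ^\<^sub>m j) $$ (i, c)) = (\<lambda>j. (A ^\<^sub>m j *\<^sub>v v) $ i)"
    using v i carrier_matD[OF pow_carrier_mat[OF A]]
    by (auto simp: scalar_prod_def mult.commute intro!: sum.cong)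
  finally show ?thesis .
qed

lemma mult_mat_unit_vec:
  fixes X :: "'a::comm_ring_1 mat"
  assumes "X \<in> carrier_mat m n" "b < n"
  shows "X *\<^sub>v unit_vec n b = col X b"
  by (rule eq_vecI) (use assms in auto)

lemma conj_pow_mat:
  fixes T :: "'a::comm_ring_1 mat"
  assumes "T \<in> carrier_mat n n" "E \<in> carrier_mat n n" "E' \<in> carrier_mat n n" "E * E' = 1\<^sub>m n" "E' * E = 1\<^sub>m n"
  shows "(E' * T * E) ^\<^sub>m M = E' * T ^\<^sub>m M * E"
proof (induction M)
  case 0
  then show ?case using assms by simp
next
  case (Suc M)
  have TM: "T ^\<^sub>m M \<in> carrier_mat n n" using assms by simp
  have "(E' * T * E) ^\<^sub>m Suc M = (E' * T ^\<^sub>m M * E) * (E' * (T * E))"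
    unfolding pow_mat.simps Suc using assms(1-3) TM
    by (simp add: assoc_mult_mat[of _ n n _ n _ n] mult_carrier_mat[of _ n n _ n])
  also have "\<dots> = E' * T ^\<^sub>m M * (E * E') * (T * E)"
    using assms(1-3) TM by (simp add: assoc_mult_mat[of _ n n _ n _ n] mult_carrier_mat[of _ n n _ n])
  also have "\<dots> = E' * T ^\<^sub>m Suc M * E"
    using assms TM by (simp add: assoc_mult_mat[of _ n n _ n _ n] mult_carrier_mat[of _ n n _ n])
  finally show ?case .
qed

text \<open>Membership in the span of the first \<open>s\<close> basis vectors.\<close>

definition low :: "nat \<Rightarrow> 'a::zero vec \<Rightarrow> bool" where
  "low s x \<longleftrightarrow> (\<forall>a. s \<le> a \<longrightarrow> a < dim_vec x \<longrightarrow> x $ a = 0)"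

lemma low_mult:
  fixes T :: "'a::comm_ring_1 mat"
  assumes "T \<in> carrier_mat n n" "x \<in> carrier_vec n" "low s x"
    and "\<And>a b. b < s \<Longrightarrow> b \<le> a \<Longrightarrow> a < n \<Longrightarrow> T $$ (a, b) = 0"
  shows "low s (T *\<^sub>v x)"
  unfolding low_def
proof (intro allI impI)
  fix a assume a: "s \<le> a" "a < dim_vec (T *\<^sub>v x)"
  have "T $$ (a, b) * x $ b = 0" if "b < n" for b
    using assms a that by (cases "b < s") (auto simp: low_def)
  then show "(T *\<^sub>v x) $ a = 0" using assms(1,2) a by (auto simp: scalar_prod_def)
qed

lemma low_fixed:
  fixes E :: "'a::comm_ring_1 mat"
  assumes "E \<in> carrier_mat n n" "x \<in> carrier_vec n" "low s x" "s \<le> n"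
    and "\<And>b. b < s \<Longrightarrow> col E b = unit_vec n b"
  shows "E *\<^sub>v x = x"
proof (rule eq_vecI)
  fix a assume "a < dim_vec x"
  then have a: "a < n" using assms by simp
  have "E $$ (a, b) * x $ b = (if b = a then x $ b else 0)" if "b < n" for b
  proof (cases "b < s")
    case True
    then have "E $$ (a, b) = unit_vec n b $ a" using assms(1) assms(5)[OF True] a that by (metis carrier_matD index_col)
    then show ?thesis using a that by simp
  next
    case False
    then show ?thesis using assms that by (auto simp: low_def)
  qed
  then have "(E *\<^sub>v x) $ a = (\<Sum>b = 0..<n. if b = a then x $ b else 0)"
    using assms(1,2) a by (auto simp: scalar_prod_def intro!: sum.cong)
  then show "(E *\<^sub>v x) $ a = x $ a" using a by simp
qed (use assms in auto)

context ladic_ring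
begin

text \<open>The vectors A^b v enter the basis one at a time: independence modulo \<open>p\<close>
  gives the next one a unit coordinate at a position not yet taken, where it can replace a basis
  vector.\<close>

lemma cyclic_basis:
  assumes A: "A \<in> carrier_mat n n" and "p \<noteq> 2"
    and v: "v \<in> carrier_vec n" "act A (geom_poly p) v = (0\<^sub>v n :: 'a vec)"
      "\<not> vec_dvd \<pi> (act A ([:- 1, 1:] ^ (p - 2)) v)"
    and "s \<le> p - 1"
  shows "s \<le> n \<and> (\<exists>P. P \<in> carrier_mat n n \<and> det P dvd 1 \<and> (\<forall>b<s. col P b = A ^\<^sub>m b *\<^sub>v v))"
  using assms(6)
proof (induction s)
  case 0
  show ?case by (rule conjI, simp, rule exI[of _ "1\<^sub>m n"]) simp
next
  case (Suc s)
  then obtain P where P: "P \<in> carrier_mat n n" "det P dvd 1" "\<And>b. b < s \<Longrightarrow> col P b = A ^\<^sub>m b *\<^sub>v v"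
    and sn: "s \<le> n" by auto
  obtain Q where Q: "Q \<in> carrier_mat n n" "P * Q = 1\<^sub>m n" "Q * P = 1\<^sub>m n" by (rule unit_det_inverse[OF P(1,2)])
  define z where "z = Q *\<^sub>v (A ^\<^sub>m s *\<^sub>v v)"
  have Av: "A ^\<^sub>m j *\<^sub>v v \<in> carrier_vec n" for j using A v by (simp add: mult_mat_vec_carrier[of _ n n])
  have z: "z \<in> carrier_vec n" using Q Av by (simp add: z_def mult_mat_vec_carrier[of _ n n])
  have Pz: "P *\<^sub>v z = A ^\<^sub>m s *\<^sub>v v"
    using P Q Av unfolding z_def by (simp add: assoc_mult_mat_vec[of _ n n _ n, symmetric])
  obtain a where a: "s \<le> a" "a < n" "\<not> \<pi> dvd z $ a"
  proof (rule ccontr)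
    assume "\<not> thesis"
    with that have dz: "\<And>a. s \<le> a \<Longrightarrow> a < n \<Longrightarrow> \<pi> dvd z $ a" by blast
    \<comment> \<open>Chosen so that c(A) v keeps only the coordinates of A^s v from position
      \<open>s\<close> on, all divisible by \<open>p\<close> under the present assumption.\<close>
    define c where "c = monom 1 s + (\<Sum>b<s. monom (- z $ b) b)"
    have cc: "coeff c j = (if j = s then 1 else if j < s then - z $ j else 0)" for j
      by (auto simp: c_def coeff_sum)
    have "degree c = s"
      by (rule antisym) (auto intro!: degree_le le_degree simp: cc)
    then have "\<not> vec_dvd \<pi> (act A (c * [:- 1, 1:] ^ 0) v)"
      using Suc.prems prime_gt_1_nat[OF prime_p]
      by (intro monic_act_not_dvd[OF A assms(2) v]) (auto simp: cc)
    moreover have "\<pi> dvd act A c v $ i" if i: "i < n" for i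
    proof -
      have "act A c v $ i = (A ^\<^sub>m s *\<^sub>v v) $ i - (\<Sum>b<s. z $ b * (A ^\<^sub>m b *\<^sub>v v) $ i)"
        unfolding act_index[OF A v(1) i] c_def
        by (simp add: umbral_add umbral_monom umbral_sum_left sum_negf)
      also have "(A ^\<^sub>m s *\<^sub>v v) $ i = (\<Sum>b<n. z $ b * P $$ (i, b))"
        using P z i unfolding Pz[symmetric]
        by (auto simp: scalar_prod_def atLeast0LessThan mult.commute intro!: sum.cong)
      also have "{..<n} = {..<s} \<union> {s..<n}" using sn by auto
      also have "(\<Sum>b\<in>{..<s} \<union> {s..<n}. z $ b * P $$ (i, b))
          = (\<Sum>b<s. z $ b * P $$ (i, b)) + (\<Sum>b = s..<n. z $ b * P $$ (i, b))"
        by (rule sum.union_disjoint) auto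
      also have "(\<Sum>b<s. z $ b * P $$ (i, b)) = (\<Sum>b<s. z $ b * (A ^\<^sub>m b *\<^sub>v v) $ i)"
        using P(1) i sn by (auto simp: P(3)[symmetric] intro!: sum.cong)
      finally have "act A c v $ i = (\<Sum>b = s..<n. z $ b * P $$ (i, b))" by simp
      then show ?thesis using dz by (auto intro!: dvd_sum)
    qed
    ultimately show False
      using carrier_vecD[OF act_carrier[OF A]] by (auto simp: vec_dvd_def)
  qed
  obtain P' where "P' \<in> carrier_mat n n" "det P' dvd 1" "\<And>b. b < s \<Longrightarrow> col P' b = col P b"
    "col P' s = P *\<^sub>v z"
    using replace_basis_column[OF P(1,2) z a(1,2)] a(3) unit_iff by blast
  then have "\<forall>b<Suc s. col P' b = A ^\<^sub>m b *\<^sub>v v" using P(3) Pz less_Suc_eq by auto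
  then show ?case using \<open>P' \<in> carrier_mat n n\<close> \<open>det P' dvd 1\<close> a by auto
qed

text \<open>On the quotient by the first \<open>s\<close> basis vectors T is still nilpotent, so it
  kills a nonzero vector there. Made primitive, that vector can be the next basis vector over the
  ring, not merely over its fraction field.\<close>

lemma flag_step:
  assumes T: "T \<in> carrier_mat n n" and nil: "T ^\<^sub>m M = (0\<^sub>m n n :: 'a mat)" and s: "s < n"
    and up: "\<forall>a b. b < s \<longrightarrow> b \<le> a \<longrightarrow> a < n \<longrightarrow> T $$ (a, b) = 0"
  shows "\<exists>E E'. E \<in> carrier_mat n n \<and> E' \<in> carrier_mat n n \<and> E * E' = 1\<^sub>m n \<and> E' * E = 1\<^sub>m n
    \<and> (\<forall>b<s. col E b = unit_vec n b)
    \<and> (\<forall>a b. b < Suc s \<longrightarrow> b \<le> a \<longrightarrow> a < n \<longrightarrow> (E' * T * E) $$ (a, b) = 0)"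
proof -
  let ?x = "\<lambda>K. T ^\<^sub>m K *\<^sub>v unit_vec n s"
  have xc: "?x K \<in> carrier_vec n" for K using T by (simp add: mult_mat_vec_carrier[of _ n n])
  have "?x M = 0\<^sub>v n" unfolding nil by (rule eq_vecI) (auto simp: scalar_prod_def)
  then have ex: "\<exists>K. low s (?x K)" by (intro exI[of _ M]) (simp add: low_def)
  \<comment> \<open>The first iterate to fall into the span of the first \<open>s\<close> basis
    vectors; the one before it is the vector killed in the quotient.\<close>
  define K where "K = (LEAST K. low s (?x K))"
  have K: "low s (?x K)" unfolding K_def by (rule LeastI_ex[OF ex])
  have "\<not> low s (?x 0)" using T s by (auto simp: low_def)
  with K have "K \<noteq> 0" by metis
  then obtain K' where K': "K = Suc K'" by (metis not0_implies_Suc)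
  define y where "y = ?x K'"
  have y: "y \<in> carrier_vec n" unfolding y_def by (rule xc)
  have nl: "\<not> low s y"
    using not_less_Least[of K' "\<lambda>K. low s (?x K)"] K' unfolding K_def y_def by simp
  have "T *\<^sub>v y = ?x K"
    using pow_mat_add[OF T, of 1 K'] T unfolding y_def K'
    by (simp add: assoc_mult_mat_vec[of _ n n _ n])
  then have Ty: "low s (T *\<^sub>v y)" using K by simp
  obtain a where "a \<in> {s..<n}" "y $ a \<noteq> 0" using nl y by (auto simp: low_def)
  \<comment> \<open>Only the coordinates from \<open>s\<close> on are made primitive. The others
    form \<open>h\<close> and may be dropped, since T preserves the span of the first
    \<open>s\<close> basis vectors.\<close>
  then obtain e g where g: "\<And>a. a \<in> {s..<n} \<Longrightarrow> y $ a = \<pi> ^ e * g a" "\<exists>a\<in>{s..<n}. \<not> \<pi> dvd g a"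
    using extract_content[of "{s..<n}" a "\<lambda>a. y $ a"] by blast
  define z where "z = vec n (\<lambda>a. if a < s then 0 else g a)"
  define h where "h = vec n (\<lambda>a. if a < s then y $ a else 0)"
  have zc: "z \<in> carrier_vec n" and hc: "h \<in> carrier_vec n" by (simp_all add: z_def h_def)
  have yz: "y = \<pi> ^ e \<cdot>\<^sub>v z + h" using y g(1) by (intro eq_vecI) (auto simp: z_def h_def)
  have "low s h" by (auto simp: low_def h_def)
  then have Th: "low s (T *\<^sub>v h)" by (rule low_mult[OF T hc]) (use up in blast)
  have Tz: "low s (T *\<^sub>v z)"
    unfolding low_def
  proof (intro allI impI)
    fix a assume a: "s \<le> a" "a < dim_vec (T *\<^sub>v z)"
    have "T *\<^sub>v y = \<pi> ^ e \<cdot>\<^sub>v (T *\<^sub>v z) + T *\<^sub>v h"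
      unfolding yz using T zc hc by (simp add: mult_add_distrib_mat_vec[of _ n n] mat_vec_smult[of _ n n])
    then have "(T *\<^sub>v y) $ a = (\<pi> ^ e \<cdot>\<^sub>v (T *\<^sub>v z) + T *\<^sub>v h) $ a" by simp
    then have "(T *\<^sub>v y) $ a = \<pi> ^ e * (T *\<^sub>v z) $ a + (T *\<^sub>v h) $ a"
      using a T by (simp del: index_mult_mat_vec)
    moreover have "(T *\<^sub>v y) $ a = 0" "(T *\<^sub>v h) $ a = 0"
      using Ty Th a T unfolding low_def by (simp_all del: index_mult_mat_vec)
    ultimately have "\<pi> ^ e * (T *\<^sub>v z) $ a = 0" by (simp del: index_mult_mat_vec)
    then show "(T *\<^sub>v z) $ a = 0" using p_nonzero by (simp del: index_mult_mat_vec)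
  qed
  obtain a where a: "s \<le> a" "a < n" "z $ a dvd 1"
    using g(2) unit_iff by (auto simp: z_def)
  have d1: "det (1\<^sub>m n :: 'a mat) dvd 1" by simp
  obtain E where E: "E \<in> carrier_mat n n" "det E dvd 1" "\<And>b. b < s \<Longrightarrow> col E b = col (1\<^sub>m n) b"
    "col E s = 1\<^sub>m n *\<^sub>v z"
    using replace_basis_column[OF one_carrier_mat d1 zc a] by blast
  have cE: "col E b = unit_vec n b" if "b < s" for b using E(3)[OF that] that s by simp
  have cs: "col E s = z" using E(4) zc by simp
  obtain E' where E': "E' \<in> carrier_mat n n" "E * E' = 1\<^sub>m n" "E' * E = 1\<^sub>m n"
    by (rule unit_det_inverse[OF E(1,2)])
  \<comment> \<open>E, hence E', fixes the span of the first \<open>s\<close> basis vectors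
    pointwise. The images under T of the first s + 1 new basis vectors lie there, so their
    coordinates do not change.\<close>
  have inv_low: "E' *\<^sub>v x = x" if "x \<in> carrier_vec n" "low t x" "t \<le> s" for x t
  proof -
    have "E *\<^sub>v x = x" using low_fixed[OF E(1) that(1,2)] that s cE by auto
    then have "E' *\<^sub>v x = E' *\<^sub>v (E *\<^sub>v x)" by simp
    also have "\<dots> = x" using E E' that by (simp add: assoc_mult_mat_vec[of _ n n _ n, symmetric])
    finally show ?thesis .
  qed
  have ET: "E' * T * E \<in> carrier_mat n n" using E E' T by (simp add: mult_carrier_mat[of _ n n _ n])
  have colT: "col (E' * T * E) b = E' *\<^sub>v (T *\<^sub>v col E b)" if "b < n" for b
  proof -
    have "col (E' * T * E) b = (E' * T * E) *\<^sub>v unit_vec n b" using ET that by (simp add: mult_mat_unit_vec)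
    also have "\<dots> = E' *\<^sub>v (T *\<^sub>v (E *\<^sub>v unit_vec n b))"
      using E E' T by (simp add: assoc_mult_mat_vec[of _ n n _ n] mult_carrier_mat[of _ n n _ n] assoc_mult_mat[of _ n n _ n _ n])
    finally show ?thesis using E that by (simp add: mult_mat_unit_vec)
  qed
  have low_col: "low b (col (E' * T * E) b)" if b: "b < Suc s" for b
  proof -
    have "low b (T *\<^sub>v col E b)"
    proof (cases "b = s")
      case True
      then show ?thesis using Tz cs by simp
    next
      case False
      then have "b < s" using b by simp
      then have "T *\<^sub>v col E b = col T b" using T s by (simp add: cE mult_mat_unit_vec)
      then show ?thesis using T up s \<open>b < s\<close> by (auto simp: low_def)
    qed
    moreover have "T *\<^sub>v col E b \<in> carrier_vec n"
      using b s by (intro mult_mat_vec_carrier[OF T] col_carrier_vec[OF _ E(1)]) simp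
    ultimately show ?thesis using colT[of b] inv_low[of "T *\<^sub>v col E b" b] b s by simp
  qed
  have "\<forall>a b. b < Suc s \<longrightarrow> b \<le> a \<longrightarrow> a < n \<longrightarrow> (E' * T * E) $$ (a, b) = 0"
    using low_col s carrier_matD[OF ET] by (auto simp: low_def)
  then show ?thesis using E(1) E' cE by blast
qed

text \<open>Iterates \<open>flag_step\<close>, with nothing to do once s0 + d reaches n. The first
  s0 basis vectors never move, which keeps the cyclotomic block intact.\<close>

lemma flag:
  assumes T: "T \<in> carrier_mat n n" and nil: "T ^\<^sub>m M = (0\<^sub>m n n :: 'a mat)" and s0: "s0 \<le> n"
    and up: "\<forall>a b. b < s0 \<longrightarrow> b \<le> a \<longrightarrow> a < n \<longrightarrow> T $$ (a, b) = 0"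
  shows "\<exists>E E'. E \<in> carrier_mat n n \<and> E' \<in> carrier_mat n n \<and> E * E' = 1\<^sub>m n \<and> E' * E = 1\<^sub>m n
    \<and> (\<forall>b<s0. col E b = unit_vec n b)
    \<and> (\<forall>a b. b < s0 + d \<longrightarrow> b \<le> a \<longrightarrow> a < n \<longrightarrow> (E' * T * E) $$ (a, b) = 0)"
proof (induction d)
  case 0
  show ?case
    by (rule exI[of _ "1\<^sub>m n"], rule exI[of _ "1\<^sub>m n"]) (use T up s0 in auto)
next
  case (Suc d)
  then obtain E E' where E: "E \<in> carrier_mat n n" "E' \<in> carrier_mat n n" "E * E' = 1\<^sub>m n" "E' * E = 1\<^sub>m n"
    and cE: "\<forall>b<s0. col E b = unit_vec n b"
    and upE: "\<forall>a b. b < s0 + d \<longrightarrow> b \<le> a \<longrightarrow> a < n \<longrightarrow> (E' * T * E) $$ (a, b) = 0"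
    by (elim exE conjE) (rule that)
  show ?case
  proof (cases "s0 + d < n")
    case False
    then have "\<forall>a b. b < s0 + Suc d \<longrightarrow> b \<le> a \<longrightarrow> a < n \<longrightarrow> (E' * T * E) $$ (a, b) = 0"
      using upE by auto
    then show ?thesis using E cE by blast
  next
    case True
    let ?T = "E' * T * E"
    have T': "?T \<in> carrier_mat n n" using E T by (simp add: mult_carrier_mat[of _ n n _ n])
    have nil': "?T ^\<^sub>m M = 0\<^sub>m n n"
      using conj_pow_mat[OF T E, of M] E unfolding nil by simp
    from flag_step[OF T' nil' True upE]
    obtain F F' where F: "F \<in> carrier_mat n n" "F' \<in> carrier_mat n n" "F * F' = 1\<^sub>m n" "F' * F = 1\<^sub>m n"
      and cF: "\<forall>b<s0 + d. col F b = unit_vec n b"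
      and upF: "\<forall>a b. b < Suc (s0 + d) \<longrightarrow> b \<le> a \<longrightarrow> a < n \<longrightarrow> (F' * ?T * F) $$ (a, b) = 0"
      by (elim exE conjE) (rule that)
    note as = assoc_mult_mat[of _ n n _ n _ n] mult_carrier_mat[of _ n n _ n]
    have "E * F * (F' * E') = E * (F * F') * E'" using E(1,2) F(1,2) by (simp add: as)
    moreover have "F' * E' * (E * F) = F' * (E' * E) * F" using E(1,2) F(1,2) by (simp add: as)
    moreover have "F' * E' * T * (E * F) = F' * ?T * F" using E(1,2) F(1,2) T by (simp add: as)
    ultimately have EF: "E * F * (F' * E') = 1\<^sub>m n" "F' * E' * (E * F) = 1\<^sub>m n"
      "\<forall>a b. b < s0 + Suc d \<longrightarrow> b \<le> a \<longrightarrow> a < n \<longrightarrow> (F' * E' * T * (E * F)) $$ (a, b) = 0"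
      using E F upF by simp_all
    have "\<forall>b<s0. col (E * F) b = unit_vec n b"
    proof (intro allI impI)
      fix b assume "b < s0"
      then have "col (E * F) b = E *\<^sub>v unit_vec n b" "b < n"
        using s0 col_mult2[OF E(1) F(1), of b] cF by simp_all
      then show "col (E * F) b = unit_vec n b"
        using E(1) cE \<open>b < s0\<close> by (simp add: mult_mat_unit_vec)
    qed
    then show ?thesis
      using EF mult_carrier_mat[OF E(1) F(1)] mult_carrier_mat[OF F(2) E(2)] by blast
  qed
qed

end

section \<open>Powers of a matrix with \<open>A\<^sup>p\<close> unipotent\<close>

context ladic_ring
begin

text \<open>The coordinates of \<open>\<zeta>\<^sup>j\<close> in the basis \<open>1, \<zeta>, \<dots>, \<zeta>\<^sup>p\<^sup>-\<^sup>2\<close> of \<open>\<int>\<^sub>p[\<zeta>]\<close>, padded with zeros.\<close>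

definition zeta_vec :: "nat \<Rightarrow> nat \<Rightarrow> 'a vec" where
  "zeta_vec n j = vec n (\<lambda>a. if a < p - 1 then (if j mod p = p - 1 then - 1 else if a = j mod p then 1 else 0) else 0)"

text \<open>The basis starts with v, A v, ..., A^(p-2) v, spanning the copy of the cyclotomic ring.
  A^p fixes these vectors, so A^p - 1 kills them, and a flag for it is completed by changing only
  the later basis vectors.\<close>

lemma normal_form:
  assumes A: "A \<in> carrier_mat n n" and "p \<noteq> 2"
    and Ap: "unipotent n (A ^\<^sub>m p)" and nu: "\<not> unipotent n (A :: 'a mat)"
  shows "p - 1 \<le> n \<and> (\<exists>P Q. P \<in> carrier_mat n n \<and> Q \<in> carrier_mat n n \<and> P * Q = 1\<^sub>m n \<and> Q * P = 1\<^sub>m n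
    \<and> (\<forall>c<p - 1. \<forall>j. (Q * A * P) ^\<^sub>m j *\<^sub>v unit_vec n c = zeta_vec n (c + j))
    \<and> (\<forall>a b. b \<le> a \<longrightarrow> a < n \<longrightarrow> ((Q * A * P) ^\<^sub>m p - 1\<^sub>m n) $$ (a, b) = 0))"
proof -
  have p2: "p > 2" using prime_p assms(2) prime_gt_1_nat[OF prime_p] by linarith
  obtain y where y: "y \<in> carrier_vec n" "y \<noteq> 0\<^sub>v n" "act A (geom_poly p) y = 0\<^sub>v n"
    by (rule exists_kernel_vector[OF A Ap nu])
  obtain v where v: "v \<in> carrier_vec n" "act A (geom_poly p) v = 0\<^sub>v n"
    "\<not> vec_dvd \<pi> (act A ([:- 1, 1:] ^ (p - 2)) v)"
    by (rule exists_saturated_vector[OF A assms(2) y])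
  obtain P where pn: "p - 1 \<le> n" and P: "P \<in> carrier_mat n n" "det P dvd 1"
    and cP: "\<forall>b<p - 1. col P b = A ^\<^sub>m b *\<^sub>v v"
    using cyclic_basis[OF A assms(2) v order_refl] by blast
  obtain Q where Q: "Q \<in> carrier_mat n n" "P * Q = 1\<^sub>m n" "Q * P = 1\<^sub>m n" by (rule unit_det_inverse[OF P])
  note as = assoc_mult_mat[of _ n n _ n _ n] mult_carrier_mat[of _ n n _ n] mult_mat_vec_carrier[of _ n n]
    assoc_mult_mat_vec[of _ n n _ n]
  have Aj: "A ^\<^sub>m j \<in> carrier_mat n n" for j using A by simp
  define C where "C = Q * A * P"
  have C: "C \<in> carrier_mat n n" using A P Q by (simp add: C_def as)
  have Cj: "C ^\<^sub>m j = Q * A ^\<^sub>m j * P" for j unfolding C_def by (rule conj_pow_mat[OF A P(1) Q])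
  define u where "u j = Q *\<^sub>v (A ^\<^sub>m j *\<^sub>v v)" for j
  have uc: "u j \<in> carrier_vec n" for j using Q Aj v by (simp add: u_def as)
  have Cu: "C ^\<^sub>m j *\<^sub>v u i = u (i + j)" for i j
  proof -
    have "C ^\<^sub>m j *\<^sub>v u i = Q *\<^sub>v (A ^\<^sub>m j *\<^sub>v (P * Q *\<^sub>v (A ^\<^sub>m i *\<^sub>v v)))"
      unfolding Cj u_def using P(1) Q(1) Aj v(1) by (simp add: as)
    also have "\<dots> = Q *\<^sub>v (A ^\<^sub>m (j + i) *\<^sub>v v)"
      using Q Aj v(1) by (simp add: as pow_mat_add[OF A])
    finally show ?thesis by (simp add: u_def add.commute)
  qed
  have ub: "u b = unit_vec n b" if "b < p - 1" for b
  proof -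
    have "u b = Q *\<^sub>v (P *\<^sub>v unit_vec n b)"
      using cP that pn P by (simp add: u_def mult_mat_unit_vec)
    also have "\<dots> = (Q * P) *\<^sub>v unit_vec n b" using P(1) Q(1) by (simp add: as)
    finally show ?thesis using Q by simp
  qed
  have "act A (monom 1 p - 1) v = 0\<^sub>v n"
    unfolding monom_minus_1_factor act_mult[OF A v(1)] v(2) by (rule act_vec_zero[OF A])
  moreover have "act A (monom 1 p) v = act A (monom 1 p - 1) v + act A 1 v"
    using act_add[OF A v(1), of "monom 1 p - 1" 1] by simp
  ultimately have "A ^\<^sub>m p *\<^sub>v v = v"
    using v(1) by (simp add: act_monom[OF A] act_1[OF A])
  then have up: "u (j + p) = u j" for j
    using Aj v(1) by (simp add: u_def pow_mat_add[OF A] as)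
  have "u (j + p * i) = u j" for i j
    by (induction i) (simp_all add: up add.assoc[symmetric] add.commute[of p])
  from this[of "_ mod p" "_ div p"] have um: "u j = u (j mod p)" for j by (metis mod_mult_div_eq)
  \<comment> \<open>The relation 1 + zeta + ... + zeta^(p-1) = 0, which determines the only one of
    these powers that is not a basis vector.\<close>
  have sum0: "(\<Sum>j<p. u j $ a) = 0" if a: "a < n" for a
  proof -
    have z: "(\<Sum>j<p. (A ^\<^sub>m j *\<^sub>v v) $ c) = 0" if "c < n" for c
      using act_index[OF A v(1) that, of "geom_poly p"] that unfolding v(2) by (simp add: umbral_geom_poly)
    have "u j $ a = (\<Sum>c<n. Q $$ (a, c) * (A ^\<^sub>m j *\<^sub>v v) $ c)" for j
      using Q Aj v(1) a carrier_vecD[OF mult_mat_vec_carrier[OF Aj v(1)], of j]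
      unfolding u_def by (simp add: scalar_prod_def atLeast0LessThan del: dim_mult_mat_vec)
    then have "(\<Sum>j<p. u j $ a) = (\<Sum>c<n. \<Sum>j<p. Q $$ (a, c) * (A ^\<^sub>m j *\<^sub>v v) $ c)"
      by (simp only: sum.swap[of _ "{..<n}"])
    also have "\<dots> = 0" by (simp only: sum_distrib_left[symmetric], rule sum.neutral) (use z in simp)
    finally show ?thesis .
  qed
  have u_last: "u (p - 1) $ a = (if a < p - 1 then - 1 else 0)" if a: "a < n" for a
  proof -
    have "p = Suc (p - 1)" using p2 by simp
    then have "(\<Sum>j<p. u j $ a) = (\<Sum>j<p - 1. u j $ a) + u (p - 1) $ a" by (metis sum.lessThan_Suc)
    also have "(\<Sum>j<p - 1. u j $ a) = (\<Sum>j<p - 1. if j = a then 1 else 0)"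
      using a pn by (intro sum.cong refl) (simp add: ub)
    also have "\<dots> = (if a < p - 1 then 1 else 0)" by simp
    finally show ?thesis using sum0[OF a] by (auto simp: eq_neg_iff_add_eq_0 add.commute split: if_splits)
  qed
  have uz: "u j = zeta_vec n j" for j
  proof (cases "j mod p = p - 1")
    case True
    then show ?thesis
      using um[of j] uc[of j] u_last by (intro eq_vecI) (auto simp: zeta_vec_def)
  next
    case False
    moreover have "j mod p < p" using p2 by simp
    ultimately have "j mod p < p - 1" by linarith
    then show ?thesis
      using um[of j] pn ub[of "j mod p"] by (intro eq_vecI) (auto simp: zeta_vec_def)
  qed
  define T where "T = C ^\<^sub>m p - 1\<^sub>m n"
  have T: "T \<in> carrier_mat n n" unfolding T_def by (intro minus_carrier_mat) simp
  have conj1: "X' * (Y - 1\<^sub>m n) * X = X' * Y * X - 1\<^sub>m n"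
    if "X \<in> carrier_mat n n" "X' \<in> carrier_mat n n" "Y \<in> carrier_mat n n" "X' * X = 1\<^sub>m n" for X X' Y :: "'a mat"
  proof -
    have "X' * (Y - 1\<^sub>m n) * X = (X' * Y - X') * X"
      using that by (simp add: mult_minus_distrib_mat[of _ n n _ n])
    also have "\<dots> = X' * Y * X - X' * X"
      using that by (intro minus_mult_distrib_mat[of _ n n _ _ n]) (simp_all add: as)
    finally show ?thesis using that by simp
  qed
  obtain M where M: "(A ^\<^sub>m p - 1\<^sub>m n) ^\<^sub>m M = 0\<^sub>m n n" using Ap by (auto simp: unipotent_def)
  have Ap1: "A ^\<^sub>m p - 1\<^sub>m n \<in> carrier_mat n n" by (intro minus_carrier_mat) simp
  have "T = Q * (A ^\<^sub>m p - 1\<^sub>m n) * P" unfolding T_def Cj by (rule conj1[symmetric, OF P(1) Q(1) Aj Q(3)])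
  then have Tnil: "T ^\<^sub>m M = 0\<^sub>m n n"
    using conj_pow_mat[OF Ap1 P(1) Q, of M] P(1) Q(1) unfolding M by simp
  have T0: "T $$ (a, b) = 0" if "b < p - 1" "b \<le> a" "a < n" for a b
  proof -
    have "b < n" using that by simp
    have "col (C ^\<^sub>m p) b = u b"
      using Cu[of p b] C \<open>b < n\<close> that(1) by (simp add: ub[symmetric] up mult_mat_unit_vec[of _ n n, symmetric])
    then have "(C ^\<^sub>m p) $$ (a, b) = unit_vec n b $ a"
      using ub[OF that(1)] \<open>b < n\<close> that(3) C by (metis carrier_matD index_col pow_carrier_mat)
    then show ?thesis using that \<open>b < n\<close> C by (simp add: T_def)
  qed
  then have "\<forall>a b. b < p - 1 \<longrightarrow> b \<le> a \<longrightarrow> a < n \<longrightarrow> T $$ (a, b) = 0" by blast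
  from flag[OF T Tnil pn this, of "n - (p - 1)"]
  obtain E E' where E: "E \<in> carrier_mat n n" "E' \<in> carrier_mat n n" "E * E' = 1\<^sub>m n" "E' * E = 1\<^sub>m n"
    and cE: "\<forall>b<p - 1. col E b = unit_vec n b"
    and upE: "\<forall>a b. b < p - 1 + (n - (p - 1)) \<longrightarrow> b \<le> a \<longrightarrow> a < n \<longrightarrow> (E' * T * E) $$ (a, b) = 0"
    by (elim exE conjE) (rule that)
  have QAP: "E' * Q * A * (P * E) = E' * C * E"
    using A P(1) Q(1) E(1,2) by (simp add: C_def as)
  have pow: "(E' * Q * A * (P * E)) ^\<^sub>m j = E' * C ^\<^sub>m j * E" for j
    unfolding QAP by (rule conj_pow_mat[OF C E])
  have Cjc: "C ^\<^sub>m j \<in> carrier_mat n n" for j using C by simp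
  have fixed: "E' *\<^sub>v u j = u j" for j
  proof -
    have "low (p - 1) (u j)" unfolding uz by (auto simp: low_def zeta_vec_def)
    then have "E *\<^sub>v u j = u j" using low_fixed[OF E(1) uc] cE pn by blast
    then have "E' *\<^sub>v u j = (E' * E) *\<^sub>v u j" using E(1,2) uc by (simp add: as)
    then show ?thesis using E uc by simp
  qed
  have "(E' * Q * A * (P * E)) ^\<^sub>m j *\<^sub>v unit_vec n c = zeta_vec n (c + j)" if c: "c < p - 1" for c j
  proof -
    have "(E' * C ^\<^sub>m j * E) *\<^sub>v unit_vec n c = E' *\<^sub>v (C ^\<^sub>m j *\<^sub>v (E *\<^sub>v unit_vec n c))"
      using E(1,2) Cjc by (simp add: as)
    also have "E *\<^sub>v unit_vec n c = u c" using E(1) cE c pn ub by (simp add: mult_mat_unit_vec)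
    finally have "(E' * C ^\<^sub>m j * E) *\<^sub>v unit_vec n c = u (c + j)" unfolding Cu fixed .
    then show ?thesis unfolding pow uz .
  qed
  moreover have "((E' * Q * A * (P * E)) ^\<^sub>m p - 1\<^sub>m n) $$ (a, b) = 0" if "b \<le> a" "a < n" for a b
    using upE that conj1[OF E(1,2) Cjc[of p] E(4)] pn unfolding pow T_def by simp
  moreover have "P * E * (E' * Q) = P * (E * E') * Q" "E' * Q * (P * E) = E' * (Q * P) * E"
    using P(1) Q(1) E(1,2) by (simp_all add: as)
  then have "P * E * (E' * Q) = 1\<^sub>m n" "E' * Q * (P * E) = 1\<^sub>m n"
    using P(1) Q E by simp_all
  moreover have "P * E \<in> carrier_mat n n" "E' * Q \<in> carrier_mat n n" using P(1) Q(1) E(1,2) by (simp_all add: as)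
  ultimately show ?thesis using pn by blast
qed

lemma unitriangular_pow:
  assumes X: "X \<in> carrier_mat n n"
    and up: "\<forall>a b. b \<le> a \<longrightarrow> a < n \<longrightarrow> (X - 1\<^sub>m n) $$ (a, b) = (0 :: 'a)"
    and ab: "b \<le> a" "a < n"
  shows "(X ^\<^sub>m j) $$ (a, b) = (if a = b then 1 else 0)"
  using ab
proof (induction j arbitrary: a b)
  case 0
  then show ?case using X by simp
next
  case (Suc j)
  have Xe: "X $$ (c, d) = (if c = d then 1 else 0)" if "d \<le> c" "c < n" for c d
    using up that X by (auto split: if_splits)
  have "(X ^\<^sub>m Suc j) $$ (a, b) = (\<Sum>c = 0..<n. (X ^\<^sub>m j) $$ (a, c) * X $$ (c, b))"
    using X Suc.prems carrier_matD[OF pow_carrier_mat[OF X, of j]] by (simp add: scalar_prod_def)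
  also have "\<dots> = (\<Sum>c = 0..<n. if c = a then X $$ (a, b) else 0)"
  proof (rule sum.cong[OF refl])
    fix c assume "c \<in> {0..<n}"
    then show "(X ^\<^sub>m j) $$ (a, c) * X $$ (c, b) = (if c = a then X $$ (a, b) else 0)"
      using Suc.IH[of c a] Suc.prems Xe[of b c] by (cases "c \<le> a") auto
  qed
  also have "\<dots> = (if a = b then 1 else 0)" using Suc.prems Xe[of b a] by simp
  finally show ?case .
qed

text \<open>A shift by r < i moves some element of {0, ..., i-1} to the gap i, the shift by i + 1
  moves 1 to i + 2, and any other shift moves 0 outside. Here 2 <= i supplies the element 1, and i +
  3 <= l keeps i + 2 from wrapping round.\<close>

lemma exists_escaping_translate:
  fixes i j l :: nat
  assumes "2 \<le> i" "i + 3 \<le> l" "\<not> l dvd j"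
  obtains c where "c < i" "\<not> (c + j) mod l < i" "(c + j) mod l \<noteq> i + 1"
proof -
  define r where "r = j mod l"
  have r: "0 < r" "r < l" using assms by (auto simp: r_def dvd_eq_mod_eq_0)
  have cj: "(c + j) mod l = c + r" if "c + r < l" for c
    unfolding r_def using that by (metis mod_add_right_eq mod_less r_def)
  consider "r < i" | "r = i + 1" | "i \<le> r" "r \<noteq> i + 1" by linarith
  then show ?thesis
  proof cases
    case 1
    then show ?thesis using cj[of "i - r"] assms r by (intro that[of "i - r"]) auto
  next
    case 2
    then show ?thesis using cj[of 1] assms by (intro that[of 1]) auto
  next
    case 3
    then show ?thesis using cj[of 0] assms r by (intro that[of 0]) auto
  qed
qed

text \<open>For a set \<open>S\<close> of \<open>i\<close> consecutive residues modulo \<open>p\<close> and an isolated further residue,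
  \<open>S\<close> is the only translate of \<open>S\<close> contained in their union. The first \<open>i\<close> rows of \<open>U\<close> and columns of
  \<open>V\<close> encode this, the remaining ones pick a unitriangular block of the powers of \<open>A\<^sup>p\<close>.\<close>

lemma delta_realization:
  assumes A: "A \<in> carrier_mat n n" and p5: "p \<ge> 5"
    and Ap: "unipotent n (A ^\<^sub>m p)" and nu: "\<not> unipotent n (A :: 'a mat)"
    and k: "2 \<le> k" "k + 2 \<le> n"
  obtains U V where "U \<in> carrier_mat k n" "V \<in> carrier_mat n k"
    "\<And>j. det (U * A ^\<^sub>m j * V) = (if p dvd j then 1 else 0)"
proof -
  have p2: "p \<noteq> 2" using p5 by simp
  from normal_form[OF A p2 Ap nu] obtain P Q where pn: "p - 1 \<le> n"
    and P: "P \<in> carrier_mat n n" and Q: "Q \<in> carrier_mat n n" and PQ: "P * Q = 1\<^sub>m n" "Q * P = 1\<^sub>m n"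
    and cyc: "\<forall>c<p - 1. \<forall>j. (Q * A * P) ^\<^sub>m j *\<^sub>v unit_vec n c = zeta_vec n (c + j)"
    and up: "\<forall>a b. b \<le> a \<longrightarrow> a < n \<longrightarrow> ((Q * A * P) ^\<^sub>m p - 1\<^sub>m n) $$ (a, b) = 0"
    by (elim exE conjE) (rule that)
  note as = assoc_mult_mat[of _ n n _ n _ n] mult_carrier_mat[of _ n n _ n]
  define C where "C = Q * A * P"
  have C: "C \<in> carrier_mat n n" using A P Q by (simp add: C_def as)
  have Cj: "C ^\<^sub>m j \<in> carrier_mat n n" for j using C by simp
  \<comment> \<open>At least 2 rows use the cyclotomic block, and enough of them that the other k -
    i fit into the n - (p-1) coordinates behind it; k + 2 <= n and p >= 5 then give i <= p -
    3.\<close>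
  define i where "i = max 2 (k + (p - 1) - n)"
  have i: "2 \<le> i" "i + 3 \<le> p" "i \<le> k" "p - 1 + (k - i) \<le> n" using p5 k pn by (auto simp: i_def)
  define g where "g c = (if c < i then c else p - 1 + (c - i))" for c
  have gn: "g c < n" if "c < k" for c using that i pn by (auto simp: g_def)
  have gm: "g c \<le> g d \<and> (g c = g d \<longleftrightarrow> c = d)" if "c \<le> d" for c d using that i by (auto simp: g_def)
  \<comment> \<open>A row r < i reads coordinate r minus coordinate i + 1. The subtraction makes it
    vanish on zeta^(p-1), whose coordinates in the block are all -1, at the price of the value -1 on
    zeta^(i+1): this is the isolated residue.\<close>
  define U0 where "U0 = mat k n (\<lambda>(r, a). (if a = g r then 1 else 0) - (if r < i \<and> a = i + 1 then 1 else (0::'a)))"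
  define V0 where "V0 = mat n k (\<lambda>(a, c). if a = g c then 1 else (0::'a))"
  have U0: "U0 \<in> carrier_mat k n" and V0: "V0 \<in> carrier_mat n k" by (simp_all add: U0_def V0_def)
  have ent: "(U0 * X * V0) $$ (r, c) = X $$ (g r, g c) - (if r < i then X $$ (i + 1, g c) else 0)"
    if X: "X \<in> carrier_mat n n" and rc: "r < k" "c < k" for X r c
  proof -
    have i1: "i + 1 < n" using i pn by simp
    have UX: "(U0 * X) $$ (r, b) = X $$ (g r, b) - (if r < i then X $$ (i + 1, b) else 0)" if "b < n" for b
    proof -
      have "(U0 * X) $$ (r, b) = (\<Sum>a = 0..<n. (if a = g r then X $$ (a, b) else 0)
          - (if a = i + 1 then (if r < i then X $$ (a, b) else 0) else 0))"
        using X rc(1) that U0 by (auto simp: scalar_prod_def U0_def algebra_simps intro!: sum.cong)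
      also have "\<dots> = X $$ (g r, b) - (if r < i then X $$ (i + 1, b) else 0)"
        unfolding sum_subtractf using gn[OF rc(1)] i1 by simp
      finally show ?thesis .
    qed
    have "(W * V0) $$ (r, c) = (\<Sum>b = 0..<n. if b = g c then W $$ (r, b) else 0)"
      if "W \<in> carrier_mat k n" for W
    proof -
      have "(W * V0) $$ (r, c) = (\<Sum>b = 0..<n. W $$ (r, b) * (if b = g c then 1 else 0))"
        using rc that V0 by (simp add: scalar_prod_def V0_def)
      also have "\<dots> = (\<Sum>b = 0..<n. if b = g c then W $$ (r, b) else 0)"
        by (rule sum.cong) simp_all
      finally show ?thesis .
    qed
    then have "(U0 * X * V0) $$ (r, c) = (\<Sum>b = 0..<n. if b = g c then (U0 * X) $$ (r, b) else 0)"
      using mult_carrier_mat[OF U0 X] by blast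
    also have "\<dots> = (U0 * X) $$ (r, g c)" using gn[OF rc(2)] by simp
    finally show ?thesis using UX[OF gn[OF rc(2)]] by simp
  qed
  have main: "det (U0 * C ^\<^sub>m j * V0) = (if p dvd j then 1 else 0)" for j
  proof (cases "p dvd j")
    case True
    then obtain j' where j': "j = p * j'" by (rule dvdE)
    \<comment> \<open>C^j is unitriangular and \<open>g\<close> is increasing. What U0 subtracts on
      or below the diagonal of the k x k matrix lies strictly below the diagonal of C^j, hence is
      0.\<close>
    have ut: "(C ^\<^sub>m j) $$ (a, b) = (if a = b then 1 else 0)" if "b \<le> a" "a < n" for a b
      unfolding j' pow_mat_mult[OF C]
      by (rule unitriangular_pow[OF Cj _ that]) (use up in \<open>simp add: C_def\<close>)
    let ?D = "U0 * C ^\<^sub>m j * V0"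
    have D: "?D \<in> carrier_mat k k" using U0 V0 Cj by (intro mult_carrier_mat) auto
    have Dl: "?D $$ (r, c) = (if r = c then 1 else 0)" if "c \<le> r" "r < k" for r c
    proof -
      have "c < k" using that by simp
      have "(C ^\<^sub>m j) $$ (g r, g c) = (if r = c then 1 else 0)"
        using ut[of "g c" "g r"] gm[OF that(1)] gn[OF that(2)] by auto
      moreover have "(C ^\<^sub>m j) $$ (i + 1, g c) = 0" if "r < i"
        using ut[of "g c" "i + 1"] that \<open>c \<le> r\<close> i pn by (auto simp: g_def)
      ultimately show ?thesis unfolding ent[OF Cj that(2) \<open>c < k\<close>] by simp
    qed
    have "upper_triangular ?D" using Dl D by (intro upper_triangularI) auto
    then have "det ?D = prod_list (diag_mat ?D)" by (rule det_upper_triangular[OF _ D])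
    also have "diag_mat ?D = map (\<lambda>r. 1) [0..<k]" using Dl D by (auto simp: diag_mat_def)
    also have "prod_list (map (\<lambda>r. 1) [0..<k]) = (1 :: 'a)" by (induction k) simp_all
    finally show ?thesis using True by simp
  next
    case False
    obtain c where c: "c < i" "\<not> (c + j) mod p < i" "(c + j) mod p \<noteq> i + 1"
      using exists_escaping_translate[OF i(1,2) False] by blast
    have ck: "c < k" and cp: "c < p - 1" using c i by auto
    have col: "(C ^\<^sub>m j) $$ (a, c) = zeta_vec n (c + j) $ a" if "a < n" for a
      using cyc cp mult_mat_unit_vec[OF Cj, of c j] carrier_matD[OF Cj, of j] that pn
      unfolding C_def[symmetric] by (metis index_col less_le_trans)
    \<comment> \<open>Column c comes from zeta^(c+j). Rows below i vanish on it by the choice of c,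
      or by the subtraction if it is zeta^(p-1); the others read coordinates outside the
      block.\<close>
    have "(U0 * C ^\<^sub>m j * V0) $$ (r, c) = 0" if "r < k" for r
      unfolding ent[OF Cj that ck] using c i pn gn[OF that]
      by (auto simp: g_def col zeta_vec_def)
    then have "det (U0 * C ^\<^sub>m j * V0) = 0"
      using U0 V0 Cj ck by (intro det_zero_col[of _ k c]) (auto intro!: mult_carrier_mat)
    then show ?thesis using False by simp
  qed
  have "U0 * Q * A ^\<^sub>m j * (P * V0) = U0 * C ^\<^sub>m j * V0" for j
  proof -
    have "C ^\<^sub>m j = Q * A ^\<^sub>m j * P" unfolding C_def by (rule conj_pow_mat[OF A P Q PQ])
    then show ?thesis
      using U0 V0 P Q pow_carrier_mat[OF A, of j]
      by (simp add: assoc_mult_mat[of _ k n _ n _ n] assoc_mult_mat[of _ k n _ n _ k]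
          assoc_mult_mat[of _ n n _ n _ k] mult_carrier_mat[of _ n n _ n] mult_carrier_mat[of _ n n _ k]
          mult_carrier_mat[of _ k n _ n])
  qed
  then show ?thesis
    using that[OF mult_carrier_mat[OF U0 Q] mult_carrier_mat[OF P V0]] main by simp
qed

lemma unipotent_of_power_p:
  assumes A: "A \<in> carrier_mat n n" and p5: "p \<ge> 5" and "m > 0" and k: "2 \<le> k" "k + 2 \<le> n"
    and Ap: "unipotent n (A ^\<^sub>m p)"
    and dvd: "mat_dvd (\<pi> ^ m) (pmat ([:- 1, 1:] ^ (m * (p - 1))) (cmat n k A))"
  shows "unipotent n A"
proof (rule ccontr)
  assume "\<not> unipotent n A"
  then obtain U V where UV: "U \<in> carrier_mat k n" "V \<in> carrier_mat n k"
    "\<And>j. det (U * A ^\<^sub>m j * V) = (if p dvd j then 1 else 0)"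
    using delta_realization[OF A p5 Ap _ k] by blast
  have "\<pi> ^ m dvd umbral ([:- 1, 1:] ^ (m * (p - 1))) (\<lambda>j. det (U * A ^\<^sub>m j * V))"
    by (rule dvd_umbral_det[OF A UV(1,2) dvd])
  then show False unfolding UV(3) using Fleck_not_dvd[of m] p5 assms(3) by simp
qed

text \<open>Each descent step needs the hypothesis for another power of A, supplied by
  \<open>mat_dvd_cmat_pow\<close>. The remaining exponent, prime to \<open>p\<close>, is removed on
  the compound and not on A, which need not be unipotent: for A = -1 and even k the compound is
  1.\<close>

lemma unipotent_compound:
  assumes A: "A \<in> carrier_mat n n" and p5: "p \<ge> 5" and "m > 0" and k: "2 \<le> k" "k + 2 \<le> n"
    and N: "N > 0" "unipotent n (A ^\<^sub>m N)"
    and dvd: "mat_dvd (\<pi> ^ m) (pmat ([:- 1, 1:] ^ (m * (p - 1))) (cmat n k A))"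
  shows "unipotent (card (ksets n k)) (cmat n k A)"
proof -
  obtain r c where c: "N = p ^ r * c" "\<not> p dvd c"
    using multiplicity_decompose'[of N p] N prime_p by (metis neq0_conv not_prime_unit)
  have "unipotent n (A ^\<^sub>m (p ^ r * c)) \<Longrightarrow> unipotent n (A ^\<^sub>m c)"
  proof (induction r)
    case (Suc r)
    let ?B = "A ^\<^sub>m (p ^ r * c)"
    have "?B ^\<^sub>m p = A ^\<^sub>m (p ^ Suc r * c)"
      by (simp add: pow_mat_mult[OF A, symmetric] ac_simps)
    then have "unipotent n (?B ^\<^sub>m p)" using Suc.prems by simp
    then have "unipotent n ?B"
      by (rule unipotent_of_power_p[OF pow_carrier_mat[OF A] p5 assms(3) k _ mat_dvd_cmat_pow[OF A dvd]])
    then show ?case by (rule Suc.IH)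
  qed simp
  then have "unipotent n (A ^\<^sub>m c)" using N c by simp
  then have "unipotent (card (ksets n k)) (cmat n k A ^\<^sub>m c)"
    using unipotent_cmat[of "A ^\<^sub>m c" n k] A by (simp add: cmat_pow)
  moreover have "mat_dvd \<pi> (pmat ([:- 1, 1:] ^ (m * (p - 1))) (cmat n k A))"
    using dvd assms(3) unfolding mat_dvd_def by (metis dvd_power dvd_trans)
  ultimately show ?thesis by (intro unipotent_of_coprime_power[OF cmat_carrier _ c(2)])
qed

end

section \<open>The ring of \<open>\<ell>\<close>-adic integers\<close>

text \<open>A type cannot depend on the variable \<open>l\<close> of the theorem. The type of \<open>\<ell>\<close>-adic integers is
  therefore built for one prime fixed in advance: one that violates the theorem, if there is any.\<close>

definition counterexample_prime :: "nat \<Rightarrow> bool" where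
  "counterexample_prime l \<longleftrightarrow> prime l \<and> l \<ge> 5 \<and> (\<exists>n k m G. ladic_family l n G \<and> quasi_unipotent_fam l n G
     \<and> m > 0 \<and> 2 \<le> k \<and> k + 2 \<le> n
     \<and> (\<forall>I\<in>ksets n k. \<forall>J\<in>ksets n k. int l ^ m dvd wedge_minus_one_pow n k (G m) (m * (l - 1)) I J)
     \<and> \<not> wedge_unipotent_fam l n k G)"

text \<open>The default 5 makes \<open>ell\<close> a prime in every case.\<close>

definition ell :: nat where
  "ell = (if \<exists>l. counterexample_prime l then SOME l. counterexample_prime l else 5)"

lemma prime_ell: "prime ell"
proof (cases "\<exists>l. counterexample_prime l")
  case True
  then have "counterexample_prime ell" unfolding ell_def by (simp add: someI_ex)
  then show ?thesis by (simp add: counterexample_prime_def)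
next
  case False
  then show ?thesis by (simp add: ell_def)
qed

definition coherent :: "(nat \<Rightarrow> int) \<Rightarrow> bool" where
  "coherent x \<longleftrightarrow> (\<forall>j. int ell ^ j dvd x (Suc j) - x j)"

text \<open>Equality in the inverse limit. The relation is partial because only coherent sequences
  represent elements.\<close>

definition padic_rel :: "(nat \<Rightarrow> int) \<Rightarrow> (nat \<Rightarrow> int) \<Rightarrow> bool" where
  "padic_rel x y \<longleftrightarrow> coherent x \<and> coherent y \<and> (\<forall>j. int ell ^ j dvd x j - y j)"

lemma coherent_const: "coherent (\<lambda>_. c)"
  by (simp add: coherent_def)

lemma coherent_add: "coherent x \<Longrightarrow> coherent y \<Longrightarrow> coherent (\<lambda>j. x j + y j)"
  unfolding coherent_def by (simp add: add_diff_add)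

lemma coherent_uminus: "coherent x \<Longrightarrow> coherent (\<lambda>j. - x j)"
  unfolding coherent_def by (simp add: dvd_diff_commute)

lemma dvd_mult_diff:
  assumes "d dvd a - a'" "d dvd b - (b' :: int)"
  shows "d dvd a * b - a' * b'"
proof -
  have "a * b - a' * b' = (a - a') * b + a' * (b - b')" by (simp add: algebra_simps)
  then show ?thesis using assms by simp
qed

lemma coherent_mult: "coherent x \<Longrightarrow> coherent y \<Longrightarrow> coherent (\<lambda>j. x j * y j)"
  unfolding coherent_def by (metis dvd_mult_diff)

lemma padic_rel_add:
  assumes "padic_rel x x'" "padic_rel y y'"
  shows "padic_rel (\<lambda>j. x j + y j) (\<lambda>j. x' j + y' j)"
  using assms unfolding padic_rel_def by (simp add: coherent_add add_diff_add)

lemma padic_rel_uminus: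
  assumes "padic_rel x x'"
  shows "padic_rel (\<lambda>j. - x j) (\<lambda>j. - x' j)"
  using assms unfolding padic_rel_def by (simp add: coherent_uminus dvd_diff_commute)

quotient_type padic = "nat \<Rightarrow> int" / partial: padic_rel
proof (rule part_equivpI)
  show "\<exists>x. padic_rel x x" by (rule exI[of _ "\<lambda>_. 0"]) (simp add: padic_rel_def coherent_const)
  show "symp padic_rel" by (rule sympI) (simp add: padic_rel_def dvd_diff_commute)
  show "transp padic_rel"
  proof (rule transpI)
    fix x y z assume "padic_rel x y" "padic_rel y z"
    then have "int ell ^ j dvd (x j - y j) + (y j - z j)" for j
      unfolding padic_rel_def by (intro dvd_add) auto
    then show "padic_rel x z" using \<open>padic_rel x y\<close> \<open>padic_rel y z\<close> by (simp add: padic_rel_def)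
  qed
qed

instantiation padic :: comm_ring_1
begin

lift_definition zero_padic :: padic is "\<lambda>_. 0" by (simp add: padic_rel_def coherent_const)
lift_definition one_padic :: padic is "\<lambda>_. 1" by (simp add: padic_rel_def coherent_const)
lift_definition plus_padic :: "padic \<Rightarrow> padic \<Rightarrow> padic" is "\<lambda>x y j. x j + y j"
  by (rule padic_rel_add)
lift_definition uminus_padic :: "padic \<Rightarrow> padic" is "\<lambda>x j. - x j"
  by (rule padic_rel_uminus)
lift_definition minus_padic :: "padic \<Rightarrow> padic \<Rightarrow> padic" is "\<lambda>x y j. x j + - y j"
  by (rule padic_rel_add[OF _ padic_rel_uminus])
lift_definition times_padic :: "padic \<Rightarrow> padic \<Rightarrow> padic" is "\<lambda>x y j. x j * y j"
  unfolding padic_rel_def by (auto simp: coherent_mult dvd_mult_diff)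

instance
proof
  fix a b c :: padic
  show "a + b + c = a + (b + c)"
    by transfer (auto simp: padic_rel_def add.assoc coherent_add)
  show "a + b = b + a"
    by transfer (auto simp: padic_rel_def add.commute coherent_add)
  show "0 + a = a" by transfer (auto simp: padic_rel_def)
  show "- a + a = 0"
    by transfer (auto simp: padic_rel_def coherent_const)
  show "a - b = a + - b"
    by transfer (auto simp: padic_rel_def coherent_add coherent_uminus simp del: add_uminus_conv_diff)
  show "a * b * c = a * (b * c)"
    by transfer (auto simp: padic_rel_def mult.assoc coherent_mult)
  show "a * b = b * a"
    by transfer (auto simp: padic_rel_def mult.commute coherent_mult)
  show "1 * a = a" by transfer (auto simp: padic_rel_def)
  show "(a + b) * c = a * c + b * c"
    by transfer (auto simp: padic_rel_def ring_distribs coherent_mult coherent_add)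
  show "(0::padic) \<noteq> 1"
  proof -
    have "\<not> int ell dvd 1" using prime_ell prime_gt_1_nat[of ell] by simp
    then have "\<exists>j. \<not> int ell ^ j dvd 0 - 1" by (intro exI[of _ 1]) simp
    then show ?thesis by transfer (simp add: padic_rel_def)
  qed
qed

end

lemma padic_rel_dvd_diff_iff:
  assumes "padic_rel x y"
  shows "int ell ^ j dvd x j - a \<longleftrightarrow> int ell ^ j dvd y j - a"
proof -
  have d: "int ell ^ j dvd x j - y j" using assms by (simp add: padic_rel_def)
  have "x j - a = (x j - y j) + (y j - a)" by simp
  then show ?thesis using dvd_add_right_iff[OF d] by metis
qed

text \<open>A relation and not a residue function: every integer congruent to x modulo ell^j is
  accepted, so approximations combine by plain integer arithmetic and match the families of the
  statement.\<close>

lift_definition approx :: "nat \<Rightarrow> padic \<Rightarrow> int \<Rightarrow> bool" is "\<lambda>j x a. int ell ^ j dvd x j - a"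
  by (simp add: padic_rel_dvd_diff_iff)

lemma approx_0: "approx j 0 0" by transfer simp
lemma approx_1: "approx j 1 1" by transfer simp

lemma approx_add: "approx j x a \<Longrightarrow> approx j y b \<Longrightarrow> approx j (x + y) (a + b)"
  by transfer (metis add_diff_add dvd_add)

lemma approx_uminus: "approx j x a \<Longrightarrow> approx j (- x) (- a)"
  by transfer (metis dvd_minus_iff minus_diff_minus)

lemma approx_diff: "approx j x a \<Longrightarrow> approx j y b \<Longrightarrow> approx j (x - y) (a - b)"
  using approx_add[of j x a "- y" "- b"] approx_uminus[of j y b] by simp

lemma approx_mult: "approx j x a \<Longrightarrow> approx j y b \<Longrightarrow> approx j (x * y) (a * b)"
  by transfer (rule dvd_mult_diff)

lemma approx_sum: "(\<And>i. i \<in> S \<Longrightarrow> approx j (f i) (g i)) \<Longrightarrow> approx j (sum f S) (sum g S)"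
  by (induction S rule: infinite_finite_induct) (auto simp: approx_0 approx_add)

lemma approx_prod: "(\<And>i. i \<in> S \<Longrightarrow> approx j (f i) (g i)) \<Longrightarrow> approx j (prod f S) (prod g S)"
  by (induction S rule: infinite_finite_induct) (auto simp: approx_1 approx_mult)

lemma approx_of_nat: "approx j (of_nat c) (int c)"
  by (induction c) (use approx_0 approx_1 approx_add in \<open>auto simp: add.commute\<close>)

lemma approx_of_int: "approx j (of_int c) c"
  by (cases c) (use approx_of_nat approx_uminus in \<open>auto simp del: of_nat_Suc\<close>)

lemma approx_power: "approx j x a \<Longrightarrow> approx j (x ^ e) (a ^ e)"
  by (induction e) (auto simp: approx_1 approx_mult)

lemma approx_cong: "approx j x a \<Longrightarrow> approx j x b \<longleftrightarrow> int ell ^ j dvd a - b"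
proof transfer
  fix j x a b assume d: "int ell ^ j dvd x j - a"
  have "x j - b = (x j - a) + (a - b)" by simp
  then show "(int ell ^ j dvd x j - b) = (int ell ^ j dvd a - b)"
    using dvd_add_right_iff[OF d] by metis
qed

lemma padic_eqI:
  assumes "\<And>j. \<exists>a. approx j x a \<and> approx j y a"
  shows "x = y"
  using assms
proof transfer
  fix x y assume xy: "padic_rel x x" "padic_rel y y"
    and *: "\<And>j. \<exists>a. int ell ^ j dvd x j - a \<and> int ell ^ j dvd y j - a"
  have "int ell ^ j dvd x j - y j" for j
  proof -
    obtain a where "int ell ^ j dvd x j - a" "int ell ^ j dvd y j - a" using * by blast
    then have "int ell ^ j dvd (x j - a) - (y j - a)" by (rule dvd_diff)
    then show ?thesis by simp
  qed
  with xy show "padic_rel x y" by (simp add: padic_rel_def)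
qed

lemma approx_ex: "\<exists>f. coherent f \<and> (\<forall>j. approx j x (f j))"
proof transfer
  fix x assume "padic_rel x x"
  then show "\<exists>f. coherent f \<and> (\<forall>j. int ell ^ j dvd x j - f j)"
    by (intro exI[of _ x]) (simp add: padic_rel_def)
qed

lemma padic_of_coherent:
  assumes "coherent f"
  shows "\<exists>x. \<forall>j. approx j x (f j)"
proof -
  have "\<exists>x. \<forall>j. approx j x (f j)" if "padic_rel f f" for f
    using that
  proof (transfer fixing: )
    fix f assume "padic_rel f f"
    then show "\<exists>x\<in>{x. padic_rel x x}. \<forall>j. int ell ^ j dvd x j - f j" by auto
  qed
  then show ?thesis using assms by (simp add: padic_rel_def)
qed

lemma approx_total: "\<exists>a. approx j x a"
  using approx_ex[of x] by blast

lemma approx_zero_iff: "approx j x a \<Longrightarrow> approx j x 0 \<longleftrightarrow> int ell ^ j dvd a"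
  using approx_cong[of j x a 0] by simp

lemma coherentD: "coherent f \<Longrightarrow> i \<le> j \<Longrightarrow> int ell ^ i dvd f (Suc j) - f j"
  unfolding coherent_def using power_le_dvd by blast

lemma padic_zero_iff: "x = 0 \<longleftrightarrow> (\<forall>j. approx j x 0)"
  using approx_0 padic_eqI[of x 0] by auto

lemma approx_ell_power: "approx j (of_nat ell ^ s) (int ell ^ s)"
  by (intro approx_power approx_of_nat)

lemma ell_pos: "int ell > 0"
  using prime_ell prime_gt_0_nat by simp

text \<open>Dividing by ell^m costs m digits, so the j-th term of the quotient is taken from f (j +
  m).\<close>

lemma ell_power_dvd_iff: "of_nat ell ^ m dvd x \<longleftrightarrow> approx m x 0"
proof
  assume "of_nat ell ^ m dvd x"
  then obtain y where y: "x = of_nat ell ^ m * y" by (rule dvdE)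
  obtain a where "approx m y a" using approx_total by blast
  then have "approx m x (int ell ^ m * a)" unfolding y by (intro approx_mult approx_ell_power)
  then show "approx m x 0" using approx_zero_iff[of m x "int ell ^ m * a"] by simp
next
  assume x0: "approx m x 0"
  obtain f where f: "coherent f" "\<forall>j. approx j x (f j)" using approx_ex by blast
  have "int ell ^ m dvd f (j + m)" for j
  proof (induction j)
    case 0
    then show ?case using x0 f(2) approx_cong[of m x "f m" 0] by simp
  next
    case (Suc j)
    have "int ell ^ m dvd f (Suc (j + m)) - f (j + m)" using f(1) by (rule coherentD) simp
    then show ?case using Suc dvd_add[of "int ell ^ m" "f (Suc (j + m)) - f (j + m)" "f (j + m)"] by simp
  qed
  then have "\<forall>j. \<exists>c. f (j + m) = int ell ^ m * c" by (auto simp: dvd_def)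
  then obtain g where g: "\<And>j. f (j + m) = int ell ^ m * g j" by metis
  have "coherent g"
    unfolding coherent_def
  proof
    fix j
    have "int ell ^ (j + m) dvd f (Suc (j + m)) - f (j + m)" using f(1) by (simp add: coherent_def)
    then have "int ell ^ m * int ell ^ j dvd int ell ^ m * (g (Suc j) - g j)"
      using g[of "Suc j"] g[of j] by (simp add: power_add mult.commute right_diff_distrib)
    then show "int ell ^ j dvd g (Suc j) - g j" using ell_pos by simp
  qed
  then obtain y where y: "\<forall>j. approx j y (g j)" using padic_of_coherent by blast
  have "x = of_nat ell ^ m * y"
  proof (rule padic_eqI)
    fix j
    have "int ell ^ j dvd f (j + i) - f j" for i
    proof (induction i)
      case (Suc i)
      have "int ell ^ j dvd f (Suc (j + i)) - f (j + i)" using f(1) by (rule coherentD) simp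
      then have "int ell ^ j dvd (f (Suc (j + i)) - f (j + i)) + (f (j + i) - f j)"
        using Suc by (rule dvd_add)
      then show ?case by simp
    qed simp
    then have "int ell ^ j dvd f j - f (j + m)" by (simp add: dvd_diff_commute)
    then have "approx j x (f (j + m))" using f(2) approx_cong by blast
    moreover have "approx j (of_nat ell ^ m * y) (f (j + m))"
      unfolding g using y by (intro approx_mult approx_ell_power) simp
    ultimately show "\<exists>a. approx j x a \<and> approx j (of_nat ell ^ m * y) a" by blast
  qed
  then show "of_nat ell ^ m dvd x" by simp
qed

text \<open>Inverses modulo ell^j exist by Bezout, and their uniqueness modulo ell^j makes them
  coherent.\<close>

lemma padic_unit:
  assumes "\<not> approx 1 x 0"
  shows "x dvd 1"
proof -
  obtain f where f: "coherent f" "\<forall>j. approx j x (f j)" using approx_ex by blast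
  have nd: "\<not> int ell dvd f (Suc j)" for j
  proof
    assume "int ell dvd f (Suc j)"
    moreover have "int ell ^ 1 dvd f (Suc j) - f 1"
    proof (induction j)
      case (Suc j)
      have "int ell ^ 1 dvd f (Suc (Suc j)) - f (Suc j)" using f(1) by (rule coherentD) simp
      then have "int ell ^ 1 dvd (f (Suc (Suc j)) - f (Suc j)) + (f (Suc j) - f 1)"
        using Suc by (rule dvd_add)
      then show ?case by simp
    qed simp
    ultimately have "int ell ^ 1 dvd f (Suc j) - (f (Suc j) - f 1)"
      unfolding power_one_right by (rule dvd_diff)
    then have "int ell ^ 1 dvd f 1" by (simp only: diff_diff_eq2 add_diff_cancel_left')
    then have "approx 1 x 0" using f(2) approx_zero_iff by blast
    with assms show False by simp
  qed
  have "\<exists>g. int ell ^ j dvd f j * g - 1" for j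
  proof (cases j)
    case (Suc i)
    have "prime (int ell)" using prime_ell by simp
    then have "coprime (int ell) (f j)" using nd[of i] Suc prime_imp_coprime by blast
    then have "coprime (f j) (int ell ^ j)" by (simp add: coprime_commute)
    then obtain u v where "u * f j + v * int ell ^ j = 1"
      using bezout_int[of "f j" "int ell ^ j"] by (auto simp: coprime_iff_gcd_eq_1)
    then have "f j * u - 1 = int ell ^ j * (- v)" by (simp add: algebra_simps)
    then show ?thesis by (metis dvd_triv_left)
  qed simp
  then obtain g where g: "\<And>j. int ell ^ j dvd f j * g j - 1" by metis
  have "coherent g"
    unfolding coherent_def
  proof
    fix j
    have a: "int ell ^ j dvd f (Suc j) * g (Suc j) - 1" by (rule power_le_dvd[OF g]) simp
    have b: "int ell ^ j dvd f (Suc j) - f j" using f(1) by (simp add: coherent_def)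
    \<comment> \<open>The combination simplifies to g (Suc j) - g j.\<close>
    have "int ell ^ j dvd g j * (f (Suc j) * g (Suc j) - 1) - g j * g (Suc j) * (f (Suc j) - f j)
        - g (Suc j) * (f j * g j - 1)"
      by (rule dvd_diff[OF dvd_diff[OF dvd_mult[OF a] dvd_mult[OF b]] dvd_mult[OF g]])
    then have "int ell ^ j dvd g (Suc j) - g j" by (simp add: algebra_simps)
    then show "int ell ^ j dvd g (Suc j) - g j" .
  qed
  then obtain y where y: "\<forall>j. approx j y (g j)" using padic_of_coherent by blast
  have "x * y = 1"
  proof (rule padic_eqI)
    fix j
    have "approx j (x * y) (f j * g j)" using f(2) y by (intro approx_mult) auto
    then have "approx j (x * y) 1" using g approx_cong by blast
    then show "\<exists>a. approx j (x * y) a \<and> approx j 1 a" using approx_1 by blast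
  qed
  then show ?thesis by (metis dvd_triv_left)
qed

text \<open>The valuation is one less than the first level at which x does not vanish.\<close>

lemma padic_valuation:
  assumes "x \<noteq> (0::padic)"
  shows "\<exists>s u. x = of_nat ell ^ s * u \<and> u dvd 1"
proof -
  have ex: "\<exists>j. \<not> approx j x 0" using assms padic_zero_iff by blast
  define j where "j = (LEAST j. \<not> approx j x 0)"
  have j: "\<not> approx j x 0" unfolding j_def by (rule LeastI_ex[OF ex])
  have "approx 0 x 0" using ell_power_dvd_iff[of 0 x] by simp
  with j obtain s where s: "j = Suc s" by (metis not0_implies_Suc)
  then have "approx s x 0" using not_less_Least[of s "\<lambda>j. \<not> approx j x 0"] unfolding j_def by auto
  then obtain u where u: "x = of_nat ell ^ s * u" using ell_power_dvd_iff[of s x] by (auto simp: dvd_def)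
  have "\<not> approx 1 u 0"
  proof
    assume "approx 1 u 0"
    then have "of_nat ell dvd u" using ell_power_dvd_iff[of 1 u] by simp
    then have "of_nat ell ^ j dvd x" unfolding u s power_Suc2 by (rule mult_dvd_mono[OF dvd_refl])
    with j show False using ell_power_dvd_iff by blast
  qed
  with u padic_unit show ?thesis by blast
qed

lemma ell_power_nonzero: "of_nat ell ^ s \<noteq> (0::padic)"
proof
  assume "of_nat ell ^ s = (0::padic)"
  then have "approx (Suc s) (of_nat ell ^ s) 0" using approx_0 by simp
  then have "int ell ^ Suc s dvd int ell ^ s"
    using approx_cong[OF approx_ell_power[of "Suc s" s], of 0] by simp
  then have "int ell ^ Suc s \<le> int ell ^ s" using ell_pos by (intro zdvd_imp_le) simp_all
  moreover have "int ell ^ s < int ell ^ Suc s"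
    using prime_ell prime_gt_1_nat[of ell] by (intro power_strict_increasing) simp_all
  ultimately show False by simp
qed

instance padic :: idom
proof
  fix x y :: padic
  assume "x \<noteq> 0" "y \<noteq> 0"
  then obtain s u t w where "x = of_nat ell ^ s * u" "y = of_nat ell ^ t * w" "u dvd 1" "w dvd 1"
    using padic_valuation by meson
  then have xy: "x * y = of_nat ell ^ (s + t) * (u * w)" and "u * w dvd 1"
    by (simp_all add: power_add ac_simps is_unit_mult_iff)
  then obtain v where "1 = u * w * v" by (metis dvdE)
  then have "x * y * v = of_nat ell ^ (s + t)" unfolding xy by (simp add: mult.assoc[symmetric]) 
      (metis mult.assoc mult.right_neutral)
  then show "x * y \<noteq> 0" using ell_power_nonzero by auto
qed

interpretation padic: ladic_ring ell "TYPE(padic)"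
proof
  show "prime ell" by (rule prime_ell)
  show "of_nat ell \<noteq> (0::padic)" using ell_power_nonzero[of 1] by simp
  show "\<not> of_nat ell dvd (1::padic)"
  proof
    assume "of_nat ell dvd (1::padic)"
    then have "approx 1 1 0" using ell_power_dvd_iff[of 1 1] by simp
    then have "int ell dvd 1" using approx_cong[OF approx_1, of 1 0] by simp
    then show False using prime_ell prime_gt_1_nat[of ell] by simp
  qed
qed (rule padic_valuation)

section \<open>Passing between \<open>padic\<close> matrices and their integer truncations\<close>

lemma approx_det:
  assumes "A \<in> carrier_mat n n" "B \<in> carrier_mat n n"
    and "\<And>a b. a < n \<Longrightarrow> b < n \<Longrightarrow> approx j (A $$ (a, b)) (B $$ (a, b))"
  shows "approx j (det A) (det B)"
  unfolding det_def'[OF assms(1)] det_def'[OF assms(2)]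
  using assms(3) by (auto intro!: approx_sum approx_mult approx_of_int approx_prod simp: permutes_less)

lemma approx_pow_mat:
  assumes A: "A \<in> carrier_mat n n" and B: "B \<in> carrier_mat n n"
    and e: "\<And>a b. a < n \<Longrightarrow> b < n \<Longrightarrow> approx j (A $$ (a, b)) (B $$ (a, b))"
  shows "a < n \<Longrightarrow> b < n \<Longrightarrow> approx j ((A ^\<^sub>m r) $$ (a, b)) ((B ^\<^sub>m r) $$ (a, b))"
proof (induction r arbitrary: a b)
  case 0
  then show ?case using A B approx_0 approx_1 by simp
next
  case (Suc r)
  then show ?case
    using A B e carrier_matD[OF pow_carrier_mat[OF A, of r]] carrier_matD[OF pow_carrier_mat[OF B, of r]]
    by (auto simp: scalar_prod_def intro!: approx_sum approx_mult)
qed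

lemma approx_smat_pow:
  assumes "\<And>I J. I \<in> S \<Longrightarrow> J \<in> S \<Longrightarrow> approx j (X I J) (Y I J)"
  shows "I \<in> S \<Longrightarrow> J \<in> S \<Longrightarrow> approx j (smat_pow S X r I J) (smat_pow S Y r I J)"
proof (induction r arbitrary: I J)
  case 0
  then show ?case using approx_0 approx_1 by (simp add: smat_one_def)
next
  case (Suc r)
  then show ?case using assms by (auto simp: smat_mult_def intro!: approx_sum approx_mult)
qed

lemma approx_wedge:
  assumes A: "A \<in> carrier_mat n n" and B: "B \<in> carrier_mat n n"
    and e: "\<And>a b. a < n \<Longrightarrow> b < n \<Longrightarrow> approx j (A $$ (a, b)) (B $$ (a, b))"
    and IJ: "I \<in> ksets n k" "J \<in> ksets n k"
  shows "approx j (smat_pow (ksets n k) (\<lambda>I J. compound k A I J - smat_one I J) r I J)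
    (wedge_minus_one_pow n k B r I J)"
  unfolding wedge_minus_one_pow_def
proof (rule approx_smat_pow[OF _ IJ])
  fix I J assume IJ: "I \<in> ksets n k" "J \<in> ksets n k"
  have "approx j (compound k A I J) (compound k B I J)"
    unfolding compound_det[OF A IJ] compound_det[OF B IJ]
    using pick_less[OF IJ(1)] pick_less[OF IJ(2)] e by (intro approx_det[of _ k]) auto
  moreover have "approx j (smat_one I J) (smat_one I J)"
    using approx_0 approx_1 by (simp add: smat_one_def)
  ultimately show "approx j (compound k A I J - smat_one I J) (compound k B I J - smat_one I J)"
    by (rule approx_diff)
qed

lemma padic_matrix_of_family:
  assumes "ladic_family ell n G"
  obtains A :: "padic mat" where "A \<in> carrier_mat n n"
    "\<And>j a b. a < n \<Longrightarrow> b < n \<Longrightarrow> approx j (A $$ (a, b)) (G j $$ (a, b))"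
proof -
  have "\<exists>x. \<forall>j. approx j x (G j $$ (a, b))" if "a < n" "b < n" for a b
    using assms that
    by (intro padic_of_coherent[of "\<lambda>j. G j $$ (a, b)"])
      (auto simp: coherent_def ladic_family_def mod_eq_dvd_iff)
  then obtain X where X: "\<And>a b j. a < n \<Longrightarrow> b < n \<Longrightarrow> approx j (X a b) (G j $$ (a, b))" by metis
  show ?thesis by (rule that[of "mat n n (\<lambda>(a, b). X a b)"]) (use X in auto)
qed

text \<open>Vanishing modulo all ell^j is vanishing over \<open>padic\<close>, while divisibility by
  ell^m is visible on the truncation \<open>G m\<close>. One exponent serves all j in the conclusion
  because it is found over \<open>padic\<close> before truncating.\<close>

lemma wedge_unipotent_ell:
  assumes fam: "ladic_family ell n G" and "ell \<ge> 5" and qu: "quasi_unipotent_fam ell n G"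
    and m: "m > 0" and k: "2 \<le> k" "k + 2 \<le> n"
    and dvd: "\<forall>I\<in>ksets n k. \<forall>J\<in>ksets n k. int ell ^ m dvd wedge_minus_one_pow n k (G m) (m * (ell - 1)) I J"
  shows "wedge_unipotent_fam ell n k G"
proof -
  obtain A where A: "A \<in> carrier_mat n n"
    and ap: "\<And>j a b. a < n \<Longrightarrow> b < n \<Longrightarrow> approx j (A $$ (a, b)) (G j $$ (a, b))"
    by (rule padic_matrix_of_family[OF fam]) blast
  have G: "G j \<in> carrier_mat n n" for j using fam by (simp add: ladic_family_def)
  let ?d = "card (ksets n k)" and ?H = "cmat n k A"
  obtain N M where N: "N > 0" "\<And>j a b. a < n \<Longrightarrow> b < n \<Longrightarrow> int ell ^ j dvd ((G j ^\<^sub>m N - 1\<^sub>m n) ^\<^sub>m M) $$ (a, b)"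
    using qu unfolding quasi_unipotent_fam_def by blast
  have X1: "X ^\<^sub>m N - 1\<^sub>m n \<in> carrier_mat n n" for X :: "'x::comm_ring_1 mat"
    by (intro minus_carrier_mat) simp
  have "(A ^\<^sub>m N - 1\<^sub>m n) ^\<^sub>m M = 0\<^sub>m n n"
  proof (rule eq_matI)
    fix a b assume "a < dim_row (0\<^sub>m n n)" "b < dim_col (0\<^sub>m n n)"
    then have ab: "a < n" "b < n" by auto
    have "approx j (((A ^\<^sub>m N - 1\<^sub>m n) ^\<^sub>m M) $$ (a, b)) 0" for j
    proof -
      have "approx j (((A ^\<^sub>m N - 1\<^sub>m n) ^\<^sub>m M) $$ (a, b)) (((G j ^\<^sub>m N - 1\<^sub>m n) ^\<^sub>m M) $$ (a, b))"
      proof (rule approx_pow_mat[OF X1 X1 _ ab])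
        fix a b assume ab: "a < n" "b < n"
        have "approx j ((A ^\<^sub>m N) $$ (a, b)) ((G j ^\<^sub>m N) $$ (a, b))"
          by (rule approx_pow_mat[OF A G ap ab])
        moreover have "approx j (1\<^sub>m n $$ (a, b)) (1\<^sub>m n $$ (a, b))"
          using ab approx_0 approx_1 by simp
        ultimately show "approx j ((A ^\<^sub>m N - 1\<^sub>m n) $$ (a, b)) ((G j ^\<^sub>m N - 1\<^sub>m n) $$ (a, b))"
          using ab approx_diff by simp
      qed
      then show ?thesis using N(2)[OF ab] approx_zero_iff by blast
    qed
    then show "((A ^\<^sub>m N - 1\<^sub>m n) ^\<^sub>m M) $$ (a, b) = 0\<^sub>m n n $$ (a, b)"
      using ab padic_zero_iff by simp
  qed (use carrier_matD[OF pow_carrier_mat[OF X1]] in simp_all)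
  then have uni: "unipotent n (A ^\<^sub>m N)" by (auto simp: unipotent_def)
  have pm: "pmat ([:- 1, 1:] ^ r) ?H = (?H - 1\<^sub>m ?d) ^\<^sub>m r" for r
    by (simp add: pmat_power[of _ ?d] pmat_linear[of _ ?d])
  have "mat_dvd (of_nat ell ^ m) (pmat ([:- 1, 1:] ^ (m * (ell - 1))) ?H)"
    unfolding mat_dvd_def
  proof (intro allI impI)
    fix a b assume "a < dim_row (pmat ([:- 1, 1:] ^ (m * (ell - 1))) ?H)"
      "b < dim_col (pmat ([:- 1, 1:] ^ (m * (ell - 1))) ?H)"
    then have ab: "a < ?d" "b < ?d" by (simp_all add: carrier_matD[OF cmat_carrier])
    have "approx m (pmat ([:- 1, 1:] ^ (m * (ell - 1))) ?H $$ (a, b))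
        (wedge_minus_one_pow n k (G m) (m * (ell - 1)) (kset_enum n k a) (kset_enum n k b))"
      unfolding pm smat_pow_cmat[OF ab, symmetric]
      by (rule approx_wedge[OF A G ap kset_enum_in[OF ab(1)] kset_enum_in[OF ab(2)]])
    then have "approx m (pmat ([:- 1, 1:] ^ (m * (ell - 1))) ?H $$ (a, b)) 0"
      using dvd kset_enum_in[OF ab(1)] kset_enum_in[OF ab(2)] approx_zero_iff by blast
    then show "of_nat ell ^ m dvd pmat ([:- 1, 1:] ^ (m * (ell - 1))) ?H $$ (a, b)"
      using ell_power_dvd_iff by blast
  qed
  then have "unipotent ?d ?H"
    by (rule padic.unipotent_compound[OF A \<open>ell \<ge> 5\<close> m k N(1) uni])
  then obtain M' where M': "(?H - 1\<^sub>m ?d) ^\<^sub>m M' = 0\<^sub>m ?d ?d" by (auto simp: unipotent_def)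
  have "int ell ^ j dvd wedge_minus_one_pow n k (G j) M' I J"
    if IJ: "I \<in> ksets n k" "J \<in> ksets n k" for j I J
  proof -
    obtain a where a: "a < ?d" "I = kset_enum n k a" by (rule kset_enum_cases[OF IJ(1)])
    obtain b where b: "b < ?d" "J = kset_enum n k b" by (rule kset_enum_cases[OF IJ(2)])
    have "approx j (smat_pow (ksets n k) (\<lambda>I J. compound k A I J - smat_one I J) M' I J)
        (wedge_minus_one_pow n k (G j) M' I J)"
      by (rule approx_wedge[OF A G ap IJ])
    moreover have "smat_pow (ksets n k) (\<lambda>I J. compound k A I J - smat_one I J) M' I J = 0"
      unfolding a(2) b(2) smat_pow_cmat[OF a(1) b(1)] M' using a(1) b(1) by simp
    ultimately show ?thesis using approx_cong[OF approx_0] by (simp add: dvd_diff_commute)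
  qed
  then show ?thesis unfolding wedge_unipotent_fam_def by blast
qed

theorem theorem3p12:
  fixes l n k m :: nat and G :: "nat \<Rightarrow> int mat"
  assumes "prime l" and "l \<ge> 5"
    and "ladic_family l n G"
    and "\<not> int l dvd det (G 1)"
    and "quasi_unipotent_fam l n G"
    and "m > 0" and "2 \<le> k" and "k + 2 \<le> n"
    and "\<forall>I\<in>ksets n k. \<forall>J\<in>ksets n k.
           int l ^ m dvd wedge_minus_one_pow n k (G m) (m * (l - 1)) I J"
  shows "wedge_unipotent_fam l n k G"
proof (rule ccontr)
  assume "\<not> wedge_unipotent_fam l n k G"
  then have "counterexample_prime l" unfolding counterexample_prime_def using assms by blast
  \<comment> \<open>\<open>ell\<close> may differ from \<open>l\<close>, but it then violates the
    theorem too, for some data of its own.\<close>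
  then have "counterexample_prime ell" unfolding ell_def using someI[of counterexample_prime l] by auto
  then show False unfolding counterexample_prime_def using wedge_unipotent_ell by blast
qed

end
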